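(* Let $C\subseteq\mathbb{Z}^2$. (i) $C$ is an 8-path in $\mathbb{Z}^2$ if and only if $\Gamma^{*}(C)$ is an arc in $\mathbb{K}^2$ with pure endpoints. (ii) $C$ is a closed 8-curve in $\mathbb{Z}^2$ if and only if $\Gamma^{*}(C)$ is a Jordan curve in $\mathbb{K}^2$.
   Context: Points $(x,y)\neq(x',y')$ of $\mathbb{Z}^2$ are 8-adjacent if $|x-x'|\le 1$ and $|y-y'|\le 1$. An 8-path is a set $\{x_0,x_1,\dots,x_n\}\subseteq\mathbb{Z}^2$ of $n+1$ distinct points, $n\ge 1$, such that for $i<j\le n$, $x_i$ and $x_j$ are 8-adjacent if and only if $j=i+1$. A closed 8-curve is a finite set $C\subseteq\mathbb{Z}^2$ such that every point of $C$ has exactly two points in $C$ that are 8-adjacent to it. $\mathbb{K}$ is $\mathbb{Z}$ with the Khalimsky topology, generated by the sets $N(n)=\{n\}$ for $n$ odd and $N(n)=\{n-1,n,n+1\}$ for $n$ even; $\mathbb{K}^2$ has the product topology. For $x\in\mathbb{K}^2$, $N(x)$ is the smallest open set containing $x$, $cl(x)$ is the closure of $\{x\}$, and $A(x)=\{y\neq x:\{x,y\}\text{ is connected}\}$. A point of $\mathbb{K}^2$ is pure if its coordinates are both even or both odd, and mixed otherwise. An arc in $\mathbb{K}^2$ is a subset which, with the subspace topology, is homeomorphic to a finite interval of $\mathbb{K}$ with at least two points; the endpoints of an arc $D$ are its two points $x$ with $|A(x)\cap D|=1$. A Jordan curve in $\mathbb{K}^2$ is a connected subset $J$ with $|J|\ge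 4$ such that $J\setminus\{x\}$ is an arc for every $x\in J$. $\Gamma:\mathbb{Z}^2\to\mathbb{K}^2$ is $\Gamma(x,y)=(x+y,y-x)$. For $A\subseteq\mathbb{Z}^2$, $$\Gamma^*(A)=\Gamma(A)\cup\{x\in\mathbb{K}^2: x\text{ is mixed and } N(x)\subseteq\Gamma(A)\cup\{x\}\text{ or } cl(x)\subseteq\Gamma(A)\cup\{x\}\}.$$
   Formalization: In (ii), a closed 8-curve is additionally required to be 8-connected and to have at least four points; without this (ii) fails, e.g. for the empty set, two far-apart curves, or the triangle {(0,0),(1,0),(0,1)}. *)

theory Defs
  imports "HOL-Analysis.Analysis"
begin

definition adj8 :: "int \<times> int \<Rightarrow> int \<times> int \<Rightarrow> bool" where
  "adj8 p q \<longleftrightarrow> p \<noteq> q \<and> \<bar>fst p - fst q\<bar> \<le> 1 \<and> \<bar>snd p - snd q\<bar> \<le> 1"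

definition path8 :: "(int \<times> int) set \<Rightarrow> bool" where
  "path8 C \<longleftrightarrow> (\<exists>(n::nat) x. n \<ge> 1 \<and> inj_on x {0..n} \<and> C = x ` {0..n} \<and>
     (\<forall>i j. i < j \<and> j \<le> n \<longrightarrow> (adj8 (x i) (x j) \<longleftrightarrow> j = i + 1)))"

definition connected8 :: "(int \<times> int) set \<Rightarrow> bool" where
  "connected8 C \<longleftrightarrow> (\<forall>p\<in>C. \<forall>q\<in>C. (p, q) \<in> {(u, v). u \<in> C \<and> v \<in> C \<and> adj8 u v}\<^sup>*)"

text \<open>A closed 8-curve is understood, as usual in digital topology, to be 8-connected and to have at
  least four points. The condition on neighbours alone is also satisfied by the empty set, by a
  disjoint union of two curves with no point of one 8-adjacent to a point of the other, and by three
  mutually 8-adjacent points, e.g. \<open>{(0,0), (1,0), (0,1)}\<close>; none of these corresponds to a Jordan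
  curve in the Khalimsky plane.\<close>

definition closed_curve8 :: "(int \<times> int) set \<Rightarrow> bool" where
  "closed_curve8 C \<longleftrightarrow> finite C \<and> (\<forall>p\<in>C. card {q \<in> C. adj8 p q} = 2) \<and>
     connected8 C \<and> card C \<ge> 4"

definition khalimsky :: "int topology" where
  "khalimsky = topology_generated_by
     ({{n} | n. odd n} \<union> {{n - 1, n, n + 1} | n. even n})"

definition K2 :: "(int \<times> int) topology" where
  "K2 = prod_topology khalimsky khalimsky"

text \<open>\<open>LEAST\<close> is with respect to inclusion; a smallest open set exists at every point by
  \<open>openin_min_nbhd\<close> below.\<close>

definition min_nbhd :: "int \<times> int \<Rightarrow> (int \<times> int) set" where
  "min_nbhd x = (LEAST U. openin K2 U \<and> x \<in> U)"

definition cl :: "int \<times> int \<Rightarrow> (int \<times> int) set" where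
  "cl x = K2 closure_of {x}"

definition adj_set :: "int \<times> int \<Rightarrow> (int \<times> int) set" where
  "adj_set x = {y. y \<noteq> x \<and> connectedin K2 {x, y}}"

definition pure :: "int \<times> int \<Rightarrow> bool" where
  "pure x \<longleftrightarrow> (even (fst x) \<and> even (snd x)) \<or> (odd (fst x) \<and> odd (snd x))"

abbreviation mixed :: "int \<times> int \<Rightarrow> bool" where
  "mixed x \<equiv> \<not> pure x"

text \<open>The finite intervals of \<open>\<int>\<close> with at least two points are the sets \<open>{a..b}\<close> with \<open>a < b\<close>.\<close>

definition arc_K2 :: "(int \<times> int) set \<Rightarrow> bool" where
  "arc_K2 D \<longleftrightarrow> (\<exists>a b. a < b \<and>
     subtopology K2 D homeomorphic_space subtopology khalimsky {a..b})"

definition arc_endpoints :: "(int \<times> int) set \<Rightarrow> (int \<times> int) set" where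
  "arc_endpoints D = {x \<in> D. card (adj_set x \<inter> D) = 1}"

text \<open>\<open>card\<close> is \<open>0\<close> on infinite sets, but the arc condition already forces \<open>J\<close> to be finite.\<close>

definition Jordan_curve_K2 :: "(int \<times> int) set \<Rightarrow> bool" where
  "Jordan_curve_K2 J \<longleftrightarrow> connectedin K2 J \<and> card J \<ge> 4 \<and> (\<forall>x\<in>J. arc_K2 (J - {x}))"

definition Gam :: "int \<times> int \<Rightarrow> int \<times> int" where
  "Gam = (\<lambda>(x, y). (x + y, y - x))"

definition Gam_star :: "(int \<times> int) set \<Rightarrow> (int \<times> int) set" where
  "Gam_star A = Gam ` A \<union>
     {x. mixed x \<and> (min_nbhd x \<subseteq> Gam ` A \<union> {x} \<or> cl x \<subseteq> Gam ` A \<union> {x})}"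

definition nbhd :: "int \<Rightarrow> int set" where
  "nbhd n = (if odd n then {n} else {n - 1, n, n + 1})"

lemma openin_khalimsky_nbhd: "openin khalimsky (nbhd n)"
  unfolding khalimsky_def nbhd_def by (intro topology_generated_by_Basis) auto

lemma nbhd_subset:
  assumes "openin khalimsky U" "n \<in> U"
  shows "nbhd n \<subseteq> U"
proof -
  have "generate_topology_on ({{n} | n. odd n} \<union> {{n - 1, n, n + 1} | n. even n}) U"
    using assms(1) unfolding khalimsky_def openin_topology_generated_by_iff .
  then show ?thesis
    using assms(2)
  proof (induction arbitrary: n)
    case (UN K)
    then show ?case
      by blast
  next
    case (Basis s)
    then consider m where "s = {m}" "odd m" | m where "s = {m - 1, m, m + 1}" "even m"
      by blast
    then show ?case
    proof cases
      case 1
      then show ?thesis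
        using Basis.prems by (simp add: nbhd_def)
    next
      case (2 m)
      then have "odd n \<or> n = m"
        using Basis.prems by auto
      then show ?thesis
        using 2 Basis.prems by (auto simp: nbhd_def)
    qed
  qed auto
qed

lemma is_min_nbhd:
  "openin K2 (nbhd (fst x) \<times> nbhd (snd x))"
  "openin K2 U \<Longrightarrow> x \<in> U \<Longrightarrow> nbhd (fst x) \<times> nbhd (snd x) \<subseteq> U"
proof -
  show "openin K2 (nbhd (fst x) \<times> nbhd (snd x))"
    by (simp add: K2_def openin_prod_Times_iff openin_khalimsky_nbhd)
  assume "openin K2 U" "x \<in> U"
  then obtain V W where "openin khalimsky V" "openin khalimsky W" "fst x \<in> V" "snd x \<in> W"
    "V \<times> W \<subseteq> U"
    unfolding K2_def openin_prod_topology_alt by (metis prod.collapse)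
  then show "nbhd (fst x) \<times> nbhd (snd x) \<subseteq> U"
    using nbhd_subset by blast
qed

lemma min_nbhd_eq: "min_nbhd x = nbhd (fst x) \<times> nbhd (snd x)"
  unfolding min_nbhd_def
proof (rule Least_equality)
  show "openin K2 (nbhd (fst x) \<times> nbhd (snd x)) \<and> x \<in> nbhd (fst x) \<times> nbhd (snd x)"
    using is_min_nbhd(1)[of x] by (simp add: mem_Times_iff nbhd_def)
qed (use is_min_nbhd(2) in blast)

lemma openin_min_nbhd:
  "openin K2 (min_nbhd x)"
  "x \<in> min_nbhd x"
  "openin K2 U \<Longrightarrow> x \<in> U \<Longrightarrow> min_nbhd x \<subseteq> U"
proof -
  show "openin K2 (min_nbhd x)"
    unfolding min_nbhd_eq by (rule is_min_nbhd(1))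
  show "x \<in> min_nbhd x"
    unfolding min_nbhd_eq by (simp add: mem_Times_iff nbhd_def)
  show "openin K2 U \<Longrightarrow> x \<in> U \<Longrightarrow> min_nbhd x \<subseteq> U"
    unfolding min_nbhd_eq by (rule is_min_nbhd(2))
qed

end

theory Submission
  imports Defs
begin

text \<open>Make \<open>K\<^sup>2\<close> a graph by joining \<open>x\<close> and \<open>y\<close> when \<open>{x, y}\<close> is connected. Arcs are then exactly the
  induced paths of this graph, and Jordan curves exactly its induced cycles. The map \<open>\<Gamma>\<close> sends
  \<open>\<int>\<^sup>2\<close> bijectively to the pure points; 8-adjacent points become either diagonal neighbours, which
  are adjacent in \<open>K\<^sup>2\<close>, or points at distance 2 on a horizontal or vertical line, whose midpoint is
  mixed and belongs to \<open>\<Gamma>\<^sup>*(C)\<close>. So \<open>\<Gamma>\<^sup>*(C)\<close> is a subdivision of the graph \<open>C\<close>, provided that no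
  added midpoint has a third neighbour, i.e. that \<open>C\<close> contains no triangle. This holds on either side
  of both equivalences, and induced paths and cycles are characterised by connectedness and vertex
  degrees, which a subdivision preserves.\<close>

section \<open>Induced paths and cycles\<close>

locale graph =
  fixes adj :: "'a \<Rightarrow> 'a \<Rightarrow> bool"
  assumes sym: "adj p q \<Longrightarrow> adj q p"
    and irrefl: "\<not> adj p p"
begin

definition nb :: "'a set \<Rightarrow> 'a \<Rightarrow> 'a set" where
  "nb D p = {q \<in> D. adj p q}"

text \<open>Phrased with subsets closed under adjacency instead of walks, so that proving or using
  connectedness means exhibiting one closed set. The empty set satisfies it.\<close>

definition gconn :: "'a set \<Rightarrow> bool" where
  "gconn D \<longleftrightarrow>
     (\<forall>S\<subseteq>D. S \<noteq> {} \<and> (\<forall>p\<in>S. \<forall>q\<in>D. adj p q \<longrightarrow> q \<in> S) \<longrightarrow> S = D)"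

text \<open>The case \<open>n = 0\<close>, excluded in \<open>induced_path\<close>, is the base of
  the induction in \<open>leaf_enumeration\<close>.\<close>

definition enumerates :: "nat \<Rightarrow> (nat \<Rightarrow> 'a) \<Rightarrow> 'a set \<Rightarrow> bool" where
  "enumerates n x D \<longleftrightarrow> inj_on x {0..n} \<and> D = x ` {0..n} \<and>
     (\<forall>i j. i < j \<and> j \<le> n \<longrightarrow> (adj (x i) (x j) \<longleftrightarrow> j = i + 1))"

definition induced_path :: "'a set \<Rightarrow> bool" where
  "induced_path D \<longleftrightarrow> (\<exists>n x. n \<ge> 1 \<and> enumerates n x D)"

definition induced_cycle :: "'a set \<Rightarrow> bool" where
  "induced_cycle D \<longleftrightarrow> finite D \<and> (\<forall>p\<in>D. card (nb D p) = 2) \<and> gconn D \<and> card D \<ge> 4"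

lemma nb_iff: "q \<in> nb D p \<longleftrightarrow> q \<in> D \<and> adj p q"
  by (simp add: nb_def)

lemma finite_nb: "finite D \<Longrightarrow> finite (nb D p)"
  by (simp add: nb_def)

lemma card_nb_mono: "finite D \<Longrightarrow> D' \<subseteq> D \<Longrightarrow> card (nb D' p) \<le> card (nb D p)"
  by (rule card_mono) (auto simp: nb_def)

lemma card_nb_remove:
  assumes "finite D" "v \<in> D"
  shows "card (nb (D - {v}) p) = card (nb D p) - (if adj p v then 1 else 0)"
proof -
  have "nb (D - {v}) p = nb D p - {v}"
    by (auto simp: nb_def)
  then show ?thesis
    using assms finite_nb[of D p] by (simp add: card_Diff_singleton_if nb_iff)
qed

lemma gconnD:
  assumes "gconn D" "S \<subseteq> D" "S \<noteq> {}" "\<And>p q. p \<in> S \<Longrightarrow> q \<in> D \<Longrightarrow> adj p q \<Longrightarrow> q \<in> S"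
  shows "S = D"
  using assms unfolding gconn_def by blast

lemma gconn_nb_nonempty:
  assumes "gconn D" "p \<in> D" "D \<noteq> {p}"
  shows "nb D p \<noteq> {}"
  using gconnD[of D "{p}"] assms by (auto simp: nb_def)

text \<open>As \<open>w\<close> is the only neighbour of \<open>v\<close>, a set closed in
  \<open>D - {v}\<close> is closed in \<open>D\<close> after adding \<open>v\<close> if it contains
  \<open>w\<close>, and unchanged otherwise.\<close>

lemma gconn_remove_leaf:
  assumes "gconn D" "nb D v = {w}"
  shows "gconn (D - {v})"
  unfolding gconn_def
proof (intro allI impI, elim conjE)
  fix S assume S: "S \<subseteq> D - {v}" "S \<noteq> {}" "\<forall>p\<in>S. \<forall>q\<in>D - {v}. adj p q \<longrightarrow> q \<in> S"
  have v: "p = w" if "p \<in> D" "adj p v" for p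
    using assms(2) sym[OF that(2)] that(1) by (auto simp: nb_def)
  have vw: "q = w" if "q \<in> D" "adj v q" for q
    using assms(2) that by (auto simp: nb_def)
  show "S = D - {v}"
  proof (cases "w \<in> S")
    case True
    have "insert v S \<inter> D = D"
      by (rule gconnD[OF assms(1)]) (use S True vw in auto)
    then show ?thesis
      using S(1) by blast
  next
    case False
    have "S = D"
      by (rule gconnD[OF assms(1)]) (use S False v in auto)
    moreover have "w \<in> D"
      using assms(2) by (auto simp: nb_def)
    ultimately show ?thesis
      using False by blast
  qed
qed

text \<open>Peel off the leaf: its neighbour \<open>w\<close> loses \<open>v\<close> and so has at
  most one neighbour in \<open>D - {v}\<close>, which stays connected, and the induction continues
  from \<open>w\<close>. No chord reaches \<open>v\<close>, whose only neighbour is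
  \<open>w\<close>.\<close>

lemma leaf_enumeration:
  assumes "card D = Suc n" "gconn D" "\<forall>p\<in>D. card (nb D p) \<le> 2"
    "v \<in> D" "card (nb D v) \<le> 1"
  shows "\<exists>x. enumerates n x D \<and> x 0 = v"
  using assms
proof (induction n arbitrary: D v)
  case 0
  then have "D = {v}"
    by (metis One_nat_def card_1_singletonE singletonD)
  then have "enumerates 0 (\<lambda>_. v) D"
    by (auto simp: enumerates_def)
  then show ?case
    by blast
next
  case (Suc n)
  have fin: "finite D"
    using Suc.prems(1) card.infinite by fastforce
  have "nb D v \<noteq> {}"
    using gconn_nb_nonempty[OF Suc.prems(2,4)] Suc.prems(1) by fastforce
  then have "card (nb D v) = 1"
    using Suc.prems(5) finite_nb[OF fin, of v] by (simp add: le_Suc_eq)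
  then obtain w where w: "nb D v = {w}"
    by (auto simp: card_1_singleton_iff)
  then have wD: "w \<in> D" and vw: "adj v w"
    by (auto simp: nb_def)
  have "w \<noteq> v"
    using vw irrefl by auto
  have "\<exists>x. enumerates n x (D - {v}) \<and> x 0 = w"
  proof (rule Suc.IH)
    show "card (D - {v}) = Suc n"
      using Suc.prems(1,4) fin by simp
    show "gconn (D - {v})"
      by (rule gconn_remove_leaf[OF Suc.prems(2) w])
    show "\<forall>p\<in>D - {v}. card (nb (D - {v}) p) \<le> 2"
      using Suc.prems(3) card_nb_remove[OF fin Suc.prems(4)] by fastforce
    show "w \<in> D - {v}"
      using wD \<open>w \<noteq> v\<close> by blast
    have "card (nb D w) \<le> 2"
      using Suc.prems(3) wD by blast
    then show "card (nb (D - {v}) w) \<le> 1"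
      using card_nb_remove[OF fin Suc.prems(4), of w] sym[OF vw] by simp
  qed
  then obtain x where x: "inj_on x {0..n}" "D - {v} = x ` {0..n}" "x 0 = w"
    "\<And>i j. i < j \<Longrightarrow> j \<le> n \<Longrightarrow> adj (x i) (x j) \<longleftrightarrow> j = i + 1"
    unfolding enumerates_def by blast
  define y where "y = case_nat v x"
  have y: "y 0 = v" "\<And>i. y (Suc i) = x i"
    by (simp_all add: y_def)
  have set: "{0..Suc n} = insert 0 (Suc ` {0..n})"
    by (rule atLeast0_atMost_Suc_eq_insert_0)
  have vx: "v \<noteq> x i" if "i \<le> n" for i
    using x(2) that by (metis Diff_iff atLeastAtMost_iff image_eqI insertI1 le0)
  have "inj_on y {0..Suc n}"
    using x(1) vx unfolding set
    by (auto simp del: image_Suc_atLeastAtMost simp add: inj_on_def y) (metis y(1))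
  moreover have "D = y ` {0..Suc n}"
    using x(2) Suc.prems(4) unfolding set
    by (auto simp del: image_Suc_atLeastAtMost simp add: image_image y)
  moreover have "adj (y i) (y j) \<longleftrightarrow> j = i + 1" if "i < j" "j \<le> Suc n" for i j
  proof -
    obtain k where k: "j = Suc k" "k \<le> n"
      using \<open>i < j\<close> \<open>j \<le> Suc n\<close> by (cases j) auto
    have "x k \<in> D"
      using x(2) k by auto
    show ?thesis
    proof (cases i)
      case 0
      have "adj v (x k) \<longleftrightarrow> x k = w"
        using w \<open>x k \<in> D\<close> by (auto simp: nb_def)
      also have "\<dots> \<longleftrightarrow> k = 0"
        using inj_onD[OF x(1), of k 0] x(3) k(2) by auto
      finally show ?thesis
        by (simp add: 0 k y)
    next
      case (Suc l)
      then show ?thesis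
        using x(4)[of l k] k that by (simp add: y)
    qed
  qed
  ultimately have "enumerates (Suc n) y D"
    unfolding enumerates_def by blast
  then show ?case
    using y(1) by blast
qed

section \<open>Degrees and connectedness of enumerated paths\<close>

lemma enumerates_adj:
  assumes "enumerates n x D" "i \<le> n" "j \<le> n"
  shows "adj (x i) (x j) \<longleftrightarrow> j = i + 1 \<or> i = j + 1"
proof -
  have *: "i < j \<Longrightarrow> j \<le> n \<Longrightarrow> adj (x i) (x j) \<longleftrightarrow> j = i + 1" for i j
    using assms(1) unfolding enumerates_def by blast
  have "adj (x j) (x i) \<longleftrightarrow> adj (x i) (x j)"
    using sym by blast
  then show ?thesis
    using *[of i j] *[of j i] assms(2,3) irrefl by (cases i j rule: linorder_cases) auto
qed

lemma enumerates_nb: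
  assumes "enumerates n x D" "i \<le> n"
  shows "nb D (x i) = x ` {j. j \<le> n \<and> (j = i + 1 \<or> i = j + 1)}"
proof -
  have D: "D = x ` {0..n}"
    using assms unfolding enumerates_def by blast
  show ?thesis
    using enumerates_adj[OF assms(1) assms(2)] unfolding nb_def D by auto
qed

lemma enumerates_card_nb:
  assumes "enumerates n x D" "i \<le> n"
  shows "card (nb D (x i)) = card {j. j \<le> n \<and> (j = i + 1 \<or> i = j + 1)}"
  unfolding enumerates_nb[OF assms]
  by (rule card_image, rule inj_on_subset[of _ "{0..n}"])
    (use assms in \<open>auto simp: enumerates_def\<close>)

lemma enumerates_ends:
  assumes "enumerates n x D" "n \<ge> 1"
  shows "card (nb D (x 0)) = 1" "card (nb D (x n)) = 1" "x 0 \<noteq> x n" "x 0 \<in> D" "x n \<in> D"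
proof -
  have "{j. j \<le> n \<and> (j = 0 + 1 \<or> 0 = j + 1)} = {1}"
    "{j. j \<le> n \<and> (j = n + 1 \<or> n = j + 1)} = {n - 1}"
    using assms(2) by auto
  then show "card (nb D (x 0)) = 1" "card (nb D (x n)) = 1"
    using enumerates_card_nb[OF assms(1), of 0] enumerates_card_nb[OF assms(1), of n] by simp_all
  show "x 0 \<noteq> x n" "x 0 \<in> D" "x n \<in> D"
    using assms unfolding enumerates_def by (auto dest: inj_onD[of x _ 0 n])
qed

lemma enumerates_gconn:
  assumes "enumerates n x D"
  shows "gconn D"
  unfolding gconn_def
proof (intro allI impI, elim conjE)
  fix S assume S: "S \<subseteq> D" "S \<noteq> {}" "\<forall>p\<in>S. \<forall>q\<in>D. adj p q \<longrightarrow> q \<in> S"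
  have D: "D = x ` {0..n}"
    using assms unfolding enumerates_def by blast
  obtain p where "p \<in> S"
    using S(2) by blast
  moreover from this have "p \<in> x ` {0..n}"
    using S(1) D by blast
  ultimately obtain k where k: "k \<le> n" "x k \<in> S"
    by auto
  have step: "x j \<in> S" if "x i \<in> S" "i \<le> n" "j \<le> n" "j = i + 1 \<or> i = j + 1" for i j
    using S(3) that enumerates_adj[OF assms that(2,3)] D by auto
  have up: "k + i \<le> n \<Longrightarrow> x (k + i) \<in> S" for i
    by (induction i) (use k step in \<open>auto simp: Suc_le_eq\<close>)
  have down: "i \<le> k \<Longrightarrow> x (k - i) \<in> S" for i
  proof (induction i)
    case (Suc i)
    then show ?case
      using step[of "k - i" "k - Suc i"] k(1) by (simp add: Suc_diff_Suc)
  qed (use k in simp)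
  have "x i \<in> S" if "i \<le> n" for i
    using up[of "i - k"] down[of "k - i"] that by (cases "k \<le> i") auto
  then show "S = D"
    using S(1) D by auto
qed

text \<open>Replaces the enumeration by connectedness and degrees, which transfer easily to a
  subdivision. The vertex of degree at most 1 rules out a cycle and starts
  \<open>leaf_enumeration\<close>; the bound on \<open>card D\<close> also gives finiteness, since
  \<open>card\<close> is 0 on infinite sets.\<close>

lemma induced_path_iff:
  "induced_path D \<longleftrightarrow> card D \<ge> 2 \<and> gconn D \<and>
     (\<forall>p\<in>D. card (nb D p) \<le> 2) \<and> (\<exists>p\<in>D. card (nb D p) \<le> 1)" (is "_ \<longleftrightarrow> ?R")
proof
  assume "induced_path D"
  then obtain n x where n: "n \<ge> 1" and x: "enumerates n x D"
    unfolding induced_path_def by blast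
  have inj: "inj_on x {0..n}" and D: "D = x ` {0..n}"
    using x unfolding enumerates_def by blast+
  have "card D = Suc n"
    unfolding D using card_image[OF inj] by simp
  moreover have "card (nb D p) \<le> 2" if "p \<in> D" for p
  proof -
    obtain i where i: "i \<le> n" "p = x i"
      using \<open>p \<in> D\<close> unfolding D by auto
    \<comment> \<open>For \<open>i = 0\<close> the truncated \<open>i - 1\<close> is 0 and not a
      neighbouring index, which is harmless in an upper bound.\<close>
    have "card {j. j \<le> n \<and> (j = i + 1 \<or> i = j + 1)} \<le> card {i + 1, i - 1}"
      by (rule card_mono) auto
    also have "\<dots> \<le> 2"
      by (simp add: card_insert_if)
    finally show ?thesis
      using enumerates_card_nb[OF x i(1)] i(2) by simp
  qed
  ultimately show ?R
    using n enumerates_gconn[OF x] enumerates_ends[OF x n] by force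
next
  assume R: ?R
  then obtain p where p: "p \<in> D" "card (nb D p) \<le> 1"
    by blast
  obtain n where n: "card D = Suc n" "n \<ge> 1"
    using R by (cases "card D") auto
  show "induced_path D"
    unfolding induced_path_def using leaf_enumeration[OF n(1) _ _ p] R n(2) by blast
qed

section \<open>Triangles and deletion of a vertex\<close>

lemma induced_path_no_triangle:
  assumes "induced_path D" "p \<in> D" "q \<in> D" "r \<in> D" "adj p q" "adj q r"
  shows "\<not> adj p r"
proof -
  obtain n x where x: "enumerates n x D"
    using assms(1) unfolding induced_path_def by blast
  then have D: "D = x ` {0..n}"
    unfolding enumerates_def by blast
  obtain i j k where "i \<le> n" "j \<le> n" "k \<le> n" "p = x i" "q = x j" "r = x k"
    using assms(2-4) unfolding D by auto
  \<comment> \<open>Adjacent indices differ by 1, so \<open>i\<close> and \<open>k\<close> differ by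
    0 or 2.\<close>
  then show ?thesis
    using assms(5,6) by (auto simp: enumerates_adj[OF x])
qed

text \<open>In a triangle each vertex has its two neighbours inside the triangle, so the triangle is
  closed under adjacency and by connectedness all of \<open>D\<close>, which has at least four
  points.\<close>

lemma induced_cycle_no_triangle:
  assumes "induced_cycle D" "p \<in> D" "q \<in> D" "r \<in> D" "adj p q" "adj q r"
  shows "\<not> adj p r"
proof
  assume "adj p r"
  have fin: "finite D"
    using assms(1) by (simp add: induced_cycle_def)
  have *: "nb D a = {b, c}"
    if "a \<in> D" "b \<in> D" "c \<in> D" "adj a b" "adj a c" "b \<noteq> c" for a b c
  proof (rule card_subset_eq[symmetric, OF finite_nb[OF fin]])
    show "{b, c} \<subseteq> nb D a"
      using that by (auto simp: nb_def)
    show "card {b, c} = card (nb D a)"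
      using that assms(1) by (simp add: induced_cycle_def)
  qed
  have ne: "p \<noteq> q" "q \<noteq> r" "p \<noteq> r"
    using assms(5,6) \<open>adj p r\<close> irrefl by auto
  have "nb D p = {q, r}" "nb D q = {p, r}" "nb D r = {p, q}"
    using * assms ne \<open>adj p r\<close> sym by metis+
  then have "{p, q, r} = D"
    using assms by (intro gconnD[of D]) (auto simp: nb_def induced_cycle_def)
  then have "card D \<le> 3"
    by (auto simp: card_insert_if)
  then show False
    using assms(1) by (simp add: induced_cycle_def)
qed

text \<open>Removing \<open>v\<close> leaves a connected set: the component of one neighbour of \<open>v\<close> is a path both of
  whose ends are neighbours of \<open>v\<close>, so together with \<open>v\<close> it is closed under adjacency.\<close>

lemma induced_cycle_remove:
  assumes "induced_cycle D" "v \<in> D"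
  shows "induced_path (D - {v})"
proof -
  have fin: "finite D" and two: "\<And>p. p \<in> D \<Longrightarrow> card (nb D p) = 2" and conn: "gconn D"
    using assms(1) by (auto simp: induced_cycle_def)
  let ?E = "D - {v}"
  have deg: "card (nb ?E p) = 2 - (if adj p v then 1 else 0)" if "p \<in> D" for p
    using card_nb_remove[OF fin assms(2)] two that by simp
  obtain a b where ab: "nb D v = {a, b}" "a \<noteq> b"
    using two[OF assms(2)] by (auto simp: card_2_iff)
  have "a \<in> nb D v"
    using ab(1) by blast
  then have aD: "a \<in> ?E" "adj a v"
    using irrefl sym by (auto simp: nb_def)
  \<comment> \<open>The connected component of \<open>a\<close> in \<open>D - {v}\<close>, obtained
    as the least closed set containing \<open>a\<close>.\<close>
  define K where "K = \<Inter>{S. S \<subseteq> ?E \<and> a \<in> S \<and> (\<forall>p\<in>S. \<forall>q\<in>?E. adj p q \<longrightarrow> q \<in> S)}"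
  have K: "K \<subseteq> ?E" "a \<in> K"
    using aD unfolding K_def by blast+
  have K_closed: "q \<in> K" if "p \<in> K" "q \<in> ?E" "adj p q" for p q
    using that unfolding K_def by blast
  have K_least: "K \<subseteq> S" if "S \<subseteq> ?E" "a \<in> S" "\<And>p q. p \<in> S \<Longrightarrow> q \<in> ?E \<Longrightarrow> adj p q \<Longrightarrow> q \<in> S" for S
    using that unfolding K_def by blast
  have nbK: "nb K p = nb ?E p" if "p \<in> K" for p
    using that K K_closed by (auto simp: nb_def)
  have "gconn K"
    unfolding gconn_def
  proof (intro allI impI, elim conjE)
    fix S assume S: "S \<subseteq> K" "S \<noteq> {}" "\<forall>p\<in>S. \<forall>q\<in>K. adj p q \<longrightarrow> q \<in> S"
    show "S = K"
    proof (cases "a \<in> S")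
      case True
      have "K \<subseteq> S"
        by (rule K_least) (use S K True K_closed in blast)+
      then show ?thesis
        using S(1) by blast
    next
      case False
      \<comment> \<open>By symmetry \<open>K - S\<close> is closed too, and it contains
        \<open>a\<close>; minimality of \<open>K\<close> then makes \<open>S\<close> empty.\<close>
      have "K \<subseteq> K - S"
        by (rule K_least) (use S K False K_closed sym in blast)+
      then show ?thesis
        using S by blast
    qed
  qed
  moreover have "card K \<ge> 2"
  proof -
    have "card (nb ?E a) = 1"
      using deg aD by simp
    then obtain c where "nb ?E a = {c}"
      by (auto simp: card_1_singleton_iff)
    then have c: "c \<in> ?E" "adj a c"
      by (auto simp: nb_def)
    then have "{a, c} \<subseteq> K" "a \<noteq> c"
      using K K_closed irrefl by auto
    moreover have "finite K"
      using K(1) fin finite_subset by blast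
    ultimately show ?thesis
      using card_mono[of K "{a, c}"] by simp
  qed
  moreover have degK: "card (nb K p) = 2 - (if adj p v then 1 else 0)" if "p \<in> K" for p
    using deg nbK[OF that] K(1) that by auto
  ultimately have "induced_path K"
    unfolding induced_path_iff using K(2) aD(2)
    by (metis diff_le_self eq_imp_le one_add_one add_diff_cancel_right')
  then obtain n x where n: "n \<ge> 1" and x: "enumerates n x K"
    unfolding induced_path_def by blast
  note ends = enumerates_ends[OF x n]
  \<comment> \<open>Degrees in \<open>K\<close> drop from 2 to 1 only by the loss of
    \<open>v\<close>, so both ends of the path are neighbours of \<open>v\<close>.\<close>
  have "adj p v" if "p \<in> K" "card (nb K p) = 1" for p
    using degK[OF that(1)] that(2) by (cases "adj p v") simp_all
  then have "adj (x 0) v" "adj (x n) v"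
    using ends(1,2,4,5) by blast+
  then have "{x 0, x n} \<subseteq> nb D v"
    using ends(4,5) K(1) sym by (auto simp: nb_def)
  then have nbv: "nb D v = {x 0, x n}"
    using ends(3) ab by auto
  have "insert v K = D"
  proof (rule gconnD[OF conn])
    show "q \<in> insert v K" if "p \<in> insert v K" "q \<in> D" "adj p q" for p q
    proof (cases "p = v")
      case True
      then have "q \<in> nb D v"
        using that by (simp add: nb_def)
      then show ?thesis
        using nbv ends(4,5) by auto
    next
      case False
      then show ?thesis
        using that K_closed by blast
    qed
  qed (use K assms(2) in auto)
  then have "?E = K"
    using K(1) by blast
  then show ?thesis
    using \<open>induced_path K\<close> by simp
qed

text \<open>Deleting a neighbour of \<open>p\<close> lowers its degree by one and still leaves a
  neighbour, as the rest is connected; so degrees are at least 2. If \<open>p\<close> had degree 3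
  or more, deleting a non-neighbour would leave too large a degree, so \<open>p\<close> would be
  adjacent to every other point. With four points a triangle through \<open>p\<close> then survives
  a deletion.\<close>

lemma induced_cycle_if_remove:
  assumes four: "card D \<ge> 4" and path: "\<And>v. v \<in> D \<Longrightarrow> induced_path (D - {v})"
  shows "induced_cycle D"
proof -
  have fin: "finite D"
    using four card.infinite by fastforce
  have avoid: "\<exists>y\<in>D. y \<notin> F" if "finite F" "card F \<le> 3" for F
  proof (rule ccontr)
    assume "\<not> ?thesis"
    then have "card D \<le> card F"
      by (intro card_mono that(1)) blast
    then show False
      using that(2) four by simp
  qed
  have le2: "card (nb (D - {v}) p) \<le> 2" if "v \<in> D" "p \<in> D" "p \<noteq> v" for v p
    using path[OF that(1)] that unfolding induced_path_iff by blast
  have nonempty: "card (nb (D - {v}) p) \<ge> 1" if "v \<in> D" "p \<in> D" "p \<noteq> v" for v p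
  proof -
    have "gconn (D - {v})" "card (D - {v}) \<ge> 2"
      using path[OF that(1)] unfolding induced_path_iff by blast+
    then have "nb (D - {v}) p \<noteq> {}"
      using gconn_nb_nonempty[of "D - {v}" p] that by fastforce
    then show ?thesis
      using finite_nb[of "D - {v}" p] fin by (simp add: Suc_le_eq card_gt_0_iff)
  qed
  have ge2: "card (nb D p) \<ge> 2" if p: "p \<in> D" for p
  proof -
    obtain v where v: "v \<in> D" "v \<noteq> p"
      using avoid[of "{p}"] by auto
    have "card (nb D p) \<ge> 1"
      using nonempty[OF v(1) p] card_nb_mono[OF fin, of "D - {v}" p] v by auto
    then obtain w where w: "w \<in> D" "adj p w"
      by (auto simp: nb_def Suc_le_eq card_gt_0_iff)
    then have "w \<noteq> p"
      using irrefl by auto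
    then show ?thesis
      using nonempty[OF w(1) p] card_nb_remove[OF fin w(1), of p] w(2) by simp
  qed
  have "card (nb D p) = 2" if p: "p \<in> D" for p
  proof (rule ccontr)
    assume "card (nb D p) \<noteq> 2"
    then have ge3: "card (nb D p) \<ge> 3"
      using ge2[OF p] by simp
    have all: "adj p q" if "q \<in> D" "q \<noteq> p" for q
      using le2[OF that(1) p] that(2) card_nb_remove[OF fin that(1), of p] ge3
      by (auto split: if_splits)
    \<comment> \<open>Every other vertex is a neighbour of \<open>p\<close>, so an edge avoiding \<open>p\<close> spans a triangle with \<open>p\<close>.\<close>
    obtain a where a: "a \<in> D" "a \<noteq> p"
      using avoid[of "{p}"] by auto
    obtain b where b: "b \<in> D" "b \<noteq> p" "adj a b"
    proof -
      have "nb (D - {p}) a \<noteq> {}"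
        using nonempty[OF p a(1,2)] by auto
      then show thesis
        using that by (auto simp: nb_def)
    qed
    obtain v where v: "v \<in> D" "v \<notin> {p, a, b}"
      using avoid[of "{p, a, b}"] card_insert_le_m1[of 3 "{a, b}" p] card_insert_le_m1[of 2 "{b}" a]
      by auto
    then show False
      using induced_path_no_triangle[OF path[OF v(1)], of p a b] a b p all by auto
  qed
  moreover have "gconn D"
    unfolding gconn_def
  proof (intro allI impI, elim conjE)
    fix S assume S: "S \<subseteq> D" "S \<noteq> {}" "\<forall>p\<in>S. \<forall>q\<in>D. adj p q \<longrightarrow> q \<in> S"
    show "S = D"
    proof (rule ccontr)
      assume "S \<noteq> D"
      then obtain v where v: "v \<in> D" "v \<notin> S"
        using S(1) by blast
      have "gconn (D - {v})"
        using path[OF v(1)] unfolding induced_path_iff by blast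
      \<comment> \<open>\<open>S\<close> is closed in \<open>D - {v}\<close> as well, hence all of
        it; then \<open>v\<close> would have no neighbour in \<open>D\<close>.\<close>
      then have SD: "S = D - {v}"
        by (rule gconnD) (use S v in auto)
      have "nb D v \<noteq> {}"
        using ge2[OF v(1)] by auto
      then obtain w where "w \<in> D" "adj v w"
        by (auto simp: nb_def)
      then show False
        using SD S(3) v irrefl sym by blast
    qed
  qed
  ultimately show ?thesis
    using fin four by (simp add: induced_cycle_def)
qed

end

section \<open>Topologies with smallest neighbourhoods\<close>

text \<open>These are the Alexandrov spaces; the relation \<open>x \<in> N y\<close> is their
  specialization preorder, to which all topological facts below reduce.\<close>

locale min_nbhd_topology =
  fixes X :: "'a topology" and N :: "'a \<Rightarrow> 'a set"
  assumes openin_N: "openin X (N x)"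
    and self_N: "x \<in> N x"
    and N_least: "openin X U \<Longrightarrow> x \<in> U \<Longrightarrow> N x \<subseteq> U"
begin

lemma openin_iff: "openin X U \<longleftrightarrow> (\<forall>x\<in>U. N x \<subseteq> U)"
  by (metis N_least openin_N openin_subopen self_N)

lemma topspace_UNIV: "topspace X = UNIV"
  using openin_N openin_subset self_N by blast

lemma openin_subtopology_iff:
  "openin (subtopology X D) U \<longleftrightarrow> U \<subseteq> D \<and> (\<forall>x\<in>U. N x \<inter> D \<subseteq> U)"
proof
  assume "openin (subtopology X D) U"
  then obtain V where "openin X V" "U = V \<inter> D"
    by (auto simp: openin_subtopology)
  then show "U \<subseteq> D \<and> (\<forall>x\<in>U. N x \<inter> D \<subseteq> U)"
    using N_least by blast
next
  assume U: "U \<subseteq> D \<and> (\<forall>x\<in>U. N x \<inter> D \<subseteq> U)"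
  have "openin X (\<Union>x\<in>U. N x)"
    using openin_N by blast
  moreover have "U = (\<Union>x\<in>U. N x) \<inter> D"
    using U self_N by blast
  ultimately show "openin (subtopology X D) U"
    by (auto simp: openin_subtopology)
qed

text \<open>If neither point lies in the smallest neighbourhood of the other, these neighbourhoods
  separate them; otherwise every open set around one of the points contains the other.\<close>

lemma connectedin_doubleton: "connectedin X {x, y} \<longleftrightarrow> x \<in> N y \<or> y \<in> N x"
proof
  assume conn: "connectedin X {x, y}"
  show "x \<in> N y \<or> y \<in> N x"
  proof (rule ccontr)
    assume "\<not> ?thesis"
    then show False
      using self_N[of x] self_N[of y] by (intro connectedinD[OF conn openin_N openin_N, of x y]) auto
  qed
next
  have *: "connectedin X {x, y}" if "x \<in> N y" for x y
    unfolding connectedin topspace_UNIV openin_iff using that by blast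
  assume "x \<in> N y \<or> y \<in> N x"
  then show "connectedin X {x, y}"
    using *[of x y] *[of y x] by (auto simp: insert_commute)
qed

end

text \<open>An isomorphism of specialization preorders is a homeomorphism, since the open sets of a
  subspace are its subsets closed under smallest neighbourhoods within it.\<close>

lemma homeomorphic_map_min_nbhd:
  assumes "min_nbhd_topology X N" "min_nbhd_topology Y M" "bij_betw f A B"
    and N: "\<And>s t. s \<in> A \<Longrightarrow> t \<in> A \<Longrightarrow> f s \<in> M (f t) \<longleftrightarrow> s \<in> N t"
  shows "homeomorphic_map (subtopology X A) (subtopology Y B) f"
proof -
  interpret X: min_nbhd_topology X N by fact
  interpret Y: min_nbhd_topology Y M by fact
  have inj: "inj_on f A" and B: "B = f ` A"
    using assms(3) by (auto simp: bij_betw_def)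
  have image: "openin (subtopology Y B) (f ` U) \<longleftrightarrow> openin (subtopology X A) U" if "U \<subseteq> A" for U
  proof -
    have "M (f t) \<inter> f ` A \<subseteq> f ` U \<longleftrightarrow> N t \<inter> A \<subseteq> U" if "t \<in> U" for t
    proof -
      have "t \<in> A"
        using that \<open>U \<subseteq> A\<close> by blast
      have "f s \<in> f ` U \<longleftrightarrow> s \<in> U" if "s \<in> A" for s
        using inj_on_image_mem_iff[OF inj that \<open>U \<subseteq> A\<close>] .
      then show ?thesis
        using N[OF _ \<open>t \<in> A\<close>] by blast
    qed
    then have "(\<forall>y\<in>f ` U. M y \<inter> f ` A \<subseteq> f ` U) \<longleftrightarrow> (\<forall>t\<in>U. N t \<inter> A \<subseteq> U)"
      by simp
    moreover have "f ` U \<subseteq> f ` A"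
      using that by (rule image_mono)
    ultimately show ?thesis
      using that unfolding X.openin_subtopology_iff Y.openin_subtopology_iff B by simp
  qed
  show ?thesis
  proof (rule bijective_open_imp_homeomorphic_map)
    show "open_map (subtopology X A) (subtopology Y B) f"
      unfolding open_map_def
    proof (intro allI impI)
      fix U assume U: "openin (subtopology X A) U"
      then have "U \<subseteq> A"
        by (simp add: X.openin_subtopology_iff)
      then show "openin (subtopology Y B) (f ` U)"
        using image U by simp
    qed
    show "continuous_map (subtopology X A) (subtopology Y B) f"
      unfolding continuous_map
    proof (intro conjI allI impI)
      fix V assume V: "openin (subtopology Y B) V"
      then have "V \<subseteq> f ` A"
        by (simp add: Y.openin_subtopology_iff B)
      then have "V = f ` {x \<in> A. f x \<in> V}"
        by blast
      then show "openin (subtopology X A) {x \<in> topspace (subtopology X A). f x \<in> V}"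
        using image[of "{x \<in> A. f x \<in> V}"] V by (simp add: X.topspace_UNIV)
    qed (auto simp: B X.topspace_UNIV Y.topspace_UNIV)
  qed (auto simp: B X.topspace_UNIV Y.topspace_UNIV inj)
qed

section \<open>Arcs and Jordan curves in the Khalimsky plane\<close>

interpretation Kh: min_nbhd_topology khalimsky nbhd
proof
  show "n \<in> nbhd n" for n
    by (simp add: nbhd_def)
qed (use openin_khalimsky_nbhd nbhd_subset in blast)+

interpretation K2: min_nbhd_topology K2 min_nbhd
  by unfold_locales (use openin_min_nbhd in blast)+

text \<open>\<open>adj_set_eq\<close> identifies this with connectedness of the pair; the present
  form exposes the specialization order behind each edge.\<close>

definition adjK :: "int \<times> int \<Rightarrow> int \<times> int \<Rightarrow> bool" where
  "adjK p q \<longleftrightarrow> p \<noteq> q \<and> (p \<in> min_nbhd q \<or> q \<in> min_nbhd p)"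

interpretation K: graph adjK
  by unfold_locales (auto simp: adjK_def)

interpretation Z: graph adj8
  by unfold_locales (auto simp: adj8_def)

lemma adj_set_eq: "adj_set p = {q. adjK p q}"
  by (auto simp: adj_set_def adjK_def K2.connectedin_doubleton)

lemma min_nbhd_trans: "p \<in> min_nbhd q \<Longrightarrow> q \<in> min_nbhd r \<Longrightarrow> p \<in> min_nbhd r"
  using openin_min_nbhd(1,3) by blast

lemma nbhd_antisym: "m \<in> nbhd n \<Longrightarrow> n \<in> nbhd m \<Longrightarrow> m = n"
  by (cases "odd m"; cases "odd n") (auto simp: nbhd_def)

lemma min_nbhd_antisym: "p \<in> min_nbhd q \<Longrightarrow> q \<in> min_nbhd p \<Longrightarrow> p = q"
  by (simp add: min_nbhd_eq mem_Times_iff nbhd_antisym prod_eqI)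

text \<open>No edge joins the two parts of a separation: an open set contains the smallest
  neighbourhoods of its points, so whichever end of the edge lies below the other would belong to
  both parts.\<close>

lemma connectedin_K2_if_gconn:
  assumes "K.gconn J"
  shows "connectedin K2 J"
  unfolding connectedin
proof (intro conjI notI; (elim exE conjE)?)
  show "J \<subseteq> topspace K2"
    by (simp add: K2.topspace_UNIV)
next
  fix E F assume EF: "openin K2 E" "openin K2 F" "J \<subseteq> E \<union> F" "E \<inter> F \<inter> J = {}"
    "E \<inter> J \<noteq> {}" "F \<inter> J \<noteq> {}"
  have "E \<inter> J = J"
  proof (rule K.gconnD[OF assms])
    fix p q assume pq: "p \<in> E \<inter> J" "q \<in> J" "adjK p q"
    then show "q \<in> E \<inter> J"
      using EF openin_min_nbhd(3)[OF EF(1), of p] openin_min_nbhd(3)[OF EF(2), of q]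
      by (auto simp: adjK_def)
  qed (use EF in auto)
  then show False
    using EF(4,6) by blast
qed

text \<open>Consecutive points alternate between the two directions of the specialization order: by
  transitivity, two successive steps in the same direction would be a chord. A path is therefore an
  interval of \<open>\<int>\<close> beginning at an even or an odd integer according to its first step.\<close>

lemma induced_path_arc_K2:
  assumes "K.induced_path D"
  shows "arc_K2 D"
proof -
  obtain n x where n: "n \<ge> 1" and x: "K.enumerates n x D"
    using assms unfolding K.induced_path_def by blast
  have inj: "inj_on x {0..n}" and D: "D = x ` {0..n}"
    using x unfolding K.enumerates_def by blast+
  note adj = K.enumerates_adj[OF x]
  define a :: int where "a = (if x 1 \<in> min_nbhd (x 0) then 0 else 1)"
  have alt: "if even (a + int i) then x (Suc i) \<in> min_nbhd (x i) else x i \<in> min_nbhd (x (Suc i))"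
    if "i < n" for i
    using that
  proof (induction i)
    case 0
    have "adjK (x 0) (x 1)"
      using adj[of 0 1] n by auto
    then show ?case
      by (auto simp: a_def adjK_def)
  next
    case (Suc i)
    have "x i \<noteq> x (Suc (Suc i))"
      using inj_onD[OF inj, of i "Suc (Suc i)"] Suc.prems by auto
    moreover have "\<not> adjK (x i) (x (Suc (Suc i)))" "adjK (x (Suc i)) (x (Suc (Suc i)))"
      using adj[of i "Suc (Suc i)"] adj[of "Suc i" "Suc (Suc i)"] Suc.prems by auto
    moreover have "if even (a + int i) then x (Suc i) \<in> min_nbhd (x i) else x i \<in> min_nbhd (x (Suc i))"
      using Suc by simp
    ultimately show ?case
      using min_nbhd_trans[of "x i" "x (Suc i)" "x (Suc (Suc i))"]
        min_nbhd_trans[of "x (Suc (Suc i))" "x (Suc i)" "x i"]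
      by (auto simp: adjK_def split: if_splits)
  qed
  \<comment> \<open>Antisymmetry excludes the reverse relation between consecutive points, and
    points further apart are not adjacent at all.\<close>
  have N: "x i \<in> min_nbhd (x j) \<longleftrightarrow> a + int i \<in> nbhd (a + int j)" if "i \<le> n" "j \<le> n" for i j
  proof -
    consider "i = j" | "i = Suc j" | "j = Suc i" | "i \<noteq> j" "i \<noteq> Suc j" "j \<noteq> Suc i"
      by blast
    then show ?thesis
    proof cases
      case 1
      then show ?thesis
        by (simp add: K2.self_N Kh.self_N)
    next
      case 2
      then have "x i \<noteq> x j"
        using inj_onD[OF inj, of i j] that by auto
      then show ?thesis
        using 2 that alt[of j] min_nbhd_antisym[of "x i" "x j"] by (auto simp: nbhd_def split: if_splits)
    next
      case 3
      then have "x i \<noteq> x j"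
        using inj_onD[OF inj, of i j] that by auto
      then show ?thesis
        using 3 that alt[of i] min_nbhd_antisym[of "x i" "x j"] by (auto simp: nbhd_def split: if_splits)
    next
      case 4
      then have "x i \<noteq> x j" "\<not> adjK (x i) (x j)"
        using inj_onD[OF inj, of i j] adj[of i j] that by auto
      then show ?thesis
        using 4 by (auto simp: adjK_def nbhd_def)
    qed
  qed
  have "bij_betw (\<lambda>s. nat (s - a)) {a..a + int n} {0..n}"
    by (rule bij_betw_byWitness[where f' = "\<lambda>i. a + int i"]) auto
  then have "bij_betw (x \<circ> (\<lambda>s. nat (s - a))) {a..a + int n} D"
    by (rule bij_betw_trans) (simp add: bij_betw_def inj D)
  then have "homeomorphic_map (subtopology khalimsky {a..a + int n}) (subtopology K2 D)
      (x \<circ> (\<lambda>s. nat (s - a)))"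
  proof (rule homeomorphic_map_min_nbhd[OF Kh.min_nbhd_topology_axioms K2.min_nbhd_topology_axioms])
    fix s t assume "s \<in> {a..a + int n}" "t \<in> {a..a + int n}"
    then show "(x \<circ> (\<lambda>s. nat (s - a))) s \<in> min_nbhd ((x \<circ> (\<lambda>s. nat (s - a))) t) \<longleftrightarrow> s \<in> nbhd t"
      using N[of "nat (s - a)" "nat (t - a)"] by auto
  qed
  then have "subtopology K2 D homeomorphic_space subtopology khalimsky {a..a + int n}"
    using homeomorphic_map_imp_homeomorphic_space homeomorphic_space_sym by blast
  then show ?thesis
    unfolding arc_K2_def using n by (intro exI[of _ a] exI[of _ "a + int n"]) auto
qed

text \<open>A homeomorphism preserves connectedness of pairs, and in \<open>khalimsky\<close> a pair
  is connected exactly when its points differ by at most 1.\<close>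

lemma arc_K2_induced_path:
  assumes "arc_K2 D"
  shows "K.induced_path D"
proof -
  obtain a b where "a < b" "subtopology K2 D homeomorphic_space subtopology khalimsky {a..b}"
    using assms unfolding arc_K2_def by blast
  then obtain g where g: "homeomorphic_map (subtopology khalimsky {a..b}) (subtopology K2 D) g"
    using homeomorphic_space homeomorphic_space_sym by blast
  have inj: "inj_on g {a..b}" and D: "D = g ` {a..b}"
    using homeomorphic_imp_injective_map[OF g] homeomorphic_imp_surjective_map[OF g]
    by (auto simp: Kh.topspace_UNIV K2.topspace_UNIV)
  have adj: "adjK (g s) (g t) \<longleftrightarrow> \<bar>s - t\<bar> = 1" if "s \<in> {a..b}" "t \<in> {a..b}" for s t
  proof -
    have "connectedin K2 (g ` {s, t}) \<longleftrightarrow> connectedin khalimsky {s, t}"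
      using homeomorphic_map_connectedness[OF g, of "{s, t}"] that D
      by (auto simp: connectedin_subtopology Kh.topspace_UNIV)
    moreover have "connectedin khalimsky {s, t} \<longleftrightarrow> \<bar>s - t\<bar> \<le> 1"
      unfolding Kh.connectedin_doubleton nbhd_def by auto presburger+
    moreover have "g s = g t \<longleftrightarrow> s = t"
      using inj_on_eq_iff[OF inj that] .
    ultimately show ?thesis
      by (auto simp: adjK_def K2.connectedin_doubleton)
  qed
  define n where "n = nat (b - a)"
  have img: "(\<lambda>i. a + int i) ` {0..n} = {a..b}"
  proof (intro equalityI subsetI)
    fix s assume "s \<in> {a..b}"
    then show "s \<in> (\<lambda>i. a + int i) ` {0..n}"
      by (intro image_eqI[of _ _ "nat (s - a)"]) (auto simp: n_def)
  qed (use \<open>a < b\<close> in \<open>auto simp: n_def\<close>)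
  have "K.enumerates n (\<lambda>i. g (a + int i)) D"
    unfolding K.enumerates_def
  proof (intro conjI allI impI)
    show "inj_on (\<lambda>i. g (a + int i)) {0..n}"
      using comp_inj_on[of "\<lambda>i. a + int i" "{0..n}" g] inj img by (auto simp: inj_on_def o_def)
    show "D = (\<lambda>i. g (a + int i)) ` {0..n}"
      unfolding D img[symmetric] by (simp add: image_image)
    show "adjK (g (a + int i)) (g (a + int j)) \<longleftrightarrow> j = i + 1" if "i < j \<and> j \<le> n" for i j
    proof -
      have "a + int i \<in> {a..b}" "a + int j \<in> {a..b}"
        using that \<open>a < b\<close> by (auto simp: n_def)
      then show ?thesis
        using adj that by auto
    qed
  qed
  moreover have "n \<ge> 1"
    using \<open>a < b\<close> by (simp add: n_def)
  ultimately show ?thesis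
    unfolding K.induced_path_def by blast
qed

lemma arc_K2_iff: "arc_K2 D \<longleftrightarrow> K.induced_path D"
  using arc_K2_induced_path induced_path_arc_K2 by blast

text \<open>\<open>arc_K2_iff\<close> turns the punctured curves into induced paths, so the two
  directions rest on the two deletion lemmas for induced cycles.\<close>

lemma Jordan_curve_K2_iff: "Jordan_curve_K2 J \<longleftrightarrow> K.induced_cycle J"
proof
  assume "Jordan_curve_K2 J"
  then show "K.induced_cycle J"
    unfolding Jordan_curve_K2_def arc_K2_iff by (intro K.induced_cycle_if_remove) auto
next
  assume J: "K.induced_cycle J"
  then show "Jordan_curve_K2 J"
    unfolding Jordan_curve_K2_def arc_K2_iff
    using K.induced_cycle_remove[OF J] connectedin_K2_if_gconn[of J] by (simp add: K.induced_cycle_def)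
qed

section \<open>8-paths and closed 8-curves as induced paths and cycles\<close>

lemma path8_iff: "path8 C \<longleftrightarrow> Z.induced_path C"
  unfolding path8_def Z.induced_path_def Z.enumerates_def by simp

lemma connected8_iff: "connected8 C \<longleftrightarrow> Z.gconn C"
proof
  let ?R = "{(u, v). u \<in> C \<and> v \<in> C \<and> adj8 u v}"
  assume C: "connected8 C"
  show "Z.gconn C"
    unfolding Z.gconn_def
  proof (intro allI impI, elim conjE)
    fix S assume S: "S \<subseteq> C" "S \<noteq> {}" "\<forall>p\<in>S. \<forall>q\<in>C. adj8 p q \<longrightarrow> q \<in> S"
    obtain p where p: "p \<in> S"
      using S(2) by blast
    have "q \<in> S" if "(p, q) \<in> ?R\<^sup>*" for q
      using that by induction (use p S(3) in auto)
    then show "S = C"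
      using C p S(1) unfolding connected8_def by blast
  qed
next
  let ?R = "{(u, v). u \<in> C \<and> v \<in> C \<and> adj8 u v}"
  assume C: "Z.gconn C"
  show "connected8 C"
    unfolding connected8_def
  proof (intro ballI)
    fix p q assume pq: "p \<in> C" "q \<in> C"
    have "{q \<in> C. (p, q) \<in> ?R\<^sup>*} = C"
    proof (rule Z.gconnD[OF C])
      fix u v assume "u \<in> {q \<in> C. (p, q) \<in> ?R\<^sup>*}" "v \<in> C" "adj8 u v"
      then show "v \<in> {q \<in> C. (p, q) \<in> ?R\<^sup>*}"
        by (auto intro: rtrancl_into_rtrancl)
    qed (use pq(1) in blast)+
    then show "(p, q) \<in> ?R\<^sup>*"
      using pq(2) by blast
  qed
qed

lemma closed_curve8_iff: "closed_curve8 C \<longleftrightarrow> Z.induced_cycle C"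
  unfolding closed_curve8_def Z.induced_cycle_def connected8_iff Z.nb_def by simp

section \<open>Pure and mixed points\<close>

lemma nbhd_iff: "m \<in> nbhd n \<longleftrightarrow> m = n \<or> even n \<and> (m = n + 1 \<or> n = m + 1)"
  by (auto simp: nbhd_def)

lemma adjK_coords:
  "adjK (a, b) (c, d) \<longleftrightarrow> (a, b) \<noteq> (c, d) \<and>
     (a \<in> nbhd c \<and> b \<in> nbhd d \<or> c \<in> nbhd a \<and> d \<in> nbhd b)"
  by (auto simp: adjK_def min_nbhd_eq)

text \<open>One coordinate is even and the other odd, so smallest neighbourhood and closure are
  three-point segments, one along each axis.\<close>

lemma adjK_mixed_coords:
  assumes "mixed (c, d)"
  shows "adjK (a, b) (c, d) \<longleftrightarrow>
    a = c \<and> (b = d + 1 \<or> d = b + 1) \<or> b = d \<and> (a = c + 1 \<or> c = a + 1)"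
  using assms unfolding adjK_coords nbhd_iff pure_def fst_conv snd_conv prod.inject by presburger

lemma adjK_mixed_mem:
  assumes "mixed (c, d)"
  shows "adjK (a, b) (c, d) \<longleftrightarrow> (a, b) \<in> {(c + 1, d), (c - 1, d), (c, d + 1), (c, d - 1)}"
  unfolding adjK_mixed_coords[OF assms] insert_iff prod.inject empty_iff by arith

text \<open>A unit step in just one coordinate destroys purity, so only diagonal steps remain; they
  join a point with even coordinates to one with odd coordinates in its smallest
  neighbourhood.\<close>

lemma adjK_pure_coords:
  assumes "pure (a, b)" "pure (c, d)"
  shows "adjK (a, b) (c, d) \<longleftrightarrow> (a = c + 1 \<or> c = a + 1) \<and> (b = d + 1 \<or> d = b + 1)"
  using assms unfolding adjK_coords nbhd_iff pure_def fst_conv snd_conv prod.inject by presburger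

text \<open>For images under \<open>Gam\<close> these are the 8-adjacent pairs that are not adjacent
  in \<open>K2\<close>, i.e. the edges to be subdivided.\<close>

definition straight :: "int \<times> int \<Rightarrow> int \<times> int \<Rightarrow> bool" where
  "straight p q \<longleftrightarrow> fst p = fst q \<and> \<bar>snd p - snd q\<bar> = 2 \<or> snd p = snd q \<and> \<bar>fst p - fst q\<bar> = 2"

text \<open>Point reflection in \<open>m\<close>: it exchanges the ends of a straight edge with
  midpoint \<open>m\<close>.\<close>

definition opp :: "int \<times> int \<Rightarrow> int \<times> int \<Rightarrow> int \<times> int" where
  "opp m p = (2 * fst m - fst p, 2 * snd m - snd p)"

lemma opp_opp [simp]: "opp m (opp m p) = p"
  by (simp add: opp_def)

lemma pure_opp [simp]: "pure (opp m p) \<longleftrightarrow> pure p"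
  by (auto simp: opp_def pure_def)

lemma opp_inj_left: "opp m p = opp n p \<Longrightarrow> m = n"
  by (auto simp: opp_def prod_eq_iff)

lemma adjK_mixed:
  assumes "mixed m" "adjK m p"
  shows "pure p" "adjK m (opp m p)" "straight p (opp m p)" "opp m p \<noteq> p"
proof -
  obtain a b c d where m: "m = (c, d)" and p: "p = (a, b)"
    by fastforce
  have *: "a = c \<and> (b = d + 1 \<or> d = b + 1) \<or> b = d \<and> (a = c + 1 \<or> c = a + 1)"
    using assms K.sym adjK_mixed_coords unfolding m p by blast
  then show "pure p"
    using assms(1) unfolding m p pure_def fst_conv snd_conv by presburger
  have "adjK (opp m p) m"
    using assms(1) * unfolding m p opp_def fst_conv snd_conv
    by (subst adjK_mixed_coords) auto
  then show "adjK m (opp m p)"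
    by (rule K.sym)
  show "straight p (opp m p)" "opp m p \<noteq> p"
    using * by (auto simp: m p opp_def straight_def)
qed

text \<open>The midpoint is one unit step away from the pure point \<open>p\<close>, hence
  mixed.\<close>

lemma straight_midpoint:
  assumes "pure p" "straight p q"
  obtains m where "mixed m" "adjK m p" "q = opp m p"
proof -
  obtain a b c d where p: "p = (a, b)" and q: "q = (c, d)"
    by fastforce
  have "a = c \<and> (b = d + 2 \<or> d = b + 2) \<or> b = d \<and> (a = c + 2 \<or> c = a + 2)"
    using assms(2) by (auto simp: p q straight_def)
  then consider "c = a" "d = b - 2" | "c = a" "d = b + 2" | "c = a - 2" "d = b" | "c = a + 2" "d = b"
    by arith
  then obtain e f where ef: "mixed (e, f)" "2 * e - a = c" "2 * f - b = d"
    "a = e \<and> (b = f + 1 \<or> f = b + 1) \<or> b = f \<and> (a = e + 1 \<or> e = a + 1)"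
  proof cases
    case 1
    then show thesis
      using assms(1) that[of a "b - 1"] by (auto simp: p pure_def)
  next
    case 2
    then show thesis
      using assms(1) that[of a "b + 1"] by (auto simp: p pure_def)
  next
    case 3
    then show thesis
      using assms(1) that[of "a - 1" b] by (auto simp: p pure_def)
  next
    case 4
    then show thesis
      using assms(1) that[of "a + 1" b] by (auto simp: p pure_def)
  qed
  then have "adjK (a, b) (e, f)"
    by (simp add: adjK_mixed_coords)
  then show thesis
    using that[of "(e, f)"] ef K.sym by (simp add: p q opp_def)
qed

lemma pure_adjK_not_straight: "pure p \<Longrightarrow> pure q \<Longrightarrow> adjK p q \<Longrightarrow> \<not> straight p q"
  by (cases p; cases q) (auto simp: adjK_pure_coords straight_def)

lemma pure_adjK_odd: "pure p \<Longrightarrow> pure q \<Longrightarrow> adjK p q \<Longrightarrow> odd (fst p - fst q)"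
  by (cases p; cases q) (auto simp: adjK_pure_coords)

text \<open>Comparing the two distances forces the coordinate of \<open>(x, y)\<close> along the
  segment from \<open>(u, v)\<close> to \<open>(-u, -v)\<close> to vanish, and the other one then
  has absolute value 1.\<close>

lemma l1_midpoint:
  fixes u v x y :: int
  assumes "\<bar>u\<bar> + \<bar>v\<bar> = 1" "\<bar>x - u\<bar> + \<bar>y - v\<bar> = 2" "\<bar>x + u\<bar> + \<bar>y + v\<bar> = 2"
  shows "\<bar>x\<bar> + \<bar>y\<bar> = 1"
proof -
  consider "u = 0" "v = 1" | "u = 0" "v = -1" | "u = 1" "v = 0" | "u = -1" "v = 0"
    using assms(1) by arith
  then show ?thesis
    using assms(2,3) by cases simp_all
qed

text \<open>Pure points that are adjacent or straight have l1-distance 2, so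
  \<open>l1_midpoint\<close> applies with \<open>m\<close> moved to the origin. Thus a triangle with
  a straight side gives the midpoint of that side a third neighbour.\<close>

lemma straight_triangle:
  assumes "pure p" "pure q" "pure r" "straight p q"
    and "adjK p r \<or> straight p r" "adjK q r \<or> straight q r" "mixed m" "adjK m p" "q = opp m p"
  shows "adjK m r"
proof -
  obtain a b c d e f where p: "p = (a, b)" and r: "r = (c, d)" and m: "m = (e, f)"
    by fastforce
  have "a = e \<and> (b = f + 1 \<or> f = b + 1) \<or> b = f \<and> (a = e + 1 \<or> e = a + 1)"
    using assms(7,8) K.sym adjK_mixed_coords unfolding m p by blast
  then have "\<bar>a - e\<bar> + \<bar>b - f\<bar> = 1"
    by auto
  moreover have "\<bar>(c - e) - (a - e)\<bar> + \<bar>(d - f) - (b - f)\<bar> = 2"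
    using assms(1,3,5) by (auto simp: p r straight_def adjK_pure_coords)
  moreover have "\<bar>(c - e) + (a - e)\<bar> + \<bar>(d - f) + (b - f)\<bar> = 2"
  proof -
    have "pure (2 * e - a, 2 * f - b)" "pure (c, d)"
      "adjK (2 * e - a, 2 * f - b) (c, d) \<or> straight (2 * e - a, 2 * f - b) (c, d)"
      using assms(2,3,6) unfolding assms(9) by (simp_all add: p r m opp_def)
    then show ?thesis
      by (auto simp: straight_def adjK_pure_coords)
  qed
  ultimately have "\<bar>c - e\<bar> + \<bar>d - f\<bar> = 1"
    by (rule l1_midpoint)
  then have "c = e \<and> (d = f + 1 \<or> f = d + 1) \<or> d = f \<and> (c = e + 1 \<or> e = c + 1)"
    by arith
  then show ?thesis
    using assms(7) K.sym adjK_mixed_coords unfolding r m by blast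
qed

section \<open>The map \<open>Gam\<close> and 8-adjacency\<close>

lemma inj_Gam: "inj Gam"
  by (auto simp: inj_def Gam_def)

lemma Gam_eq_iff [simp]: "Gam p = Gam q \<longleftrightarrow> p = q"
  by (rule inj_eq[OF inj_Gam])

lemma pure_Gam: "pure (Gam p)"
  by (auto simp: Gam_def pure_def split: prod.split)

text \<open>Since |x + y| + |y - x| = 2 max(|x|, |y|), points are 8-adjacent exactly when their
  images have l1-distance 2. Horizontal and vertical neighbours become diagonal, diagonal neighbours
  become straight.\<close>

lemma adj8_iff: "adj8 p q \<longleftrightarrow> adjK (Gam p) (Gam q) \<or> straight (Gam p) (Gam q)"
proof -
  obtain a b c d where p: "p = (a, b)" and q: "q = (c, d)"
    by fastforce
  define x y where "x = a - c" and "y = b - d"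
  have adjK: "adjK (Gam p) (Gam q) \<longleftrightarrow> \<bar>x + y\<bar> = 1 \<and> \<bar>y - x\<bar> = 1"
    using pure_Gam[of p] pure_Gam[of q] unfolding p q Gam_def prod.case x_def y_def
    by (subst adjK_pure_coords) (assumption | arith)+
  have straight: "straight (Gam p) (Gam q) \<longleftrightarrow>
      x + y = 0 \<and> \<bar>y - x\<bar> = 2 \<or> y - x = 0 \<and> \<bar>x + y\<bar> = 2"
    by (auto simp: straight_def p q Gam_def x_def y_def)
  have "adj8 p q \<longleftrightarrow> (x \<noteq> 0 \<or> y \<noteq> 0) \<and> \<bar>x\<bar> \<le> 1 \<and> \<bar>y\<bar> \<le> 1"
    by (auto simp: adj8_def p q x_def y_def)
  also have "\<dots> \<longleftrightarrow> \<bar>x + y\<bar> = 1 \<and> \<bar>y - x\<bar> = 1 \<or>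
      x + y = 0 \<and> \<bar>y - x\<bar> = 2 \<or> y - x = 0 \<and> \<bar>x + y\<bar> = 2"
    by (smt (verit))
  finally show ?thesis
    unfolding adjK straight .
qed

text \<open>Any two of the four neighbours of a mixed point have l1-distance 2. This is what turns a
  third neighbour of an added midpoint into a triangle in \<open>C\<close>.\<close>

lemma mixed_nbs_adj8:
  assumes "mixed m" "adjK m (Gam p)" "adjK m (Gam q)" "p \<noteq> q"
  shows "adj8 p q"
proof -
  obtain a b c d e f where m: "m = (e, f)" and p: "Gam p = (a, b)" and q: "Gam q = (c, d)"
    by fastforce
  have "adjK (a, b) (e, f)" "adjK (c, d) (e, f)"
    using assms(2,3) K.sym unfolding m p q by blast+
  then have "(a, b) \<in> {(e + 1, f), (e - 1, f), (e, f + 1), (e, f - 1)}"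
    "(c, d) \<in> {(e + 1, f), (e - 1, f), (e, f + 1), (e, f - 1)}"
    by (simp_all only: adjK_mixed_mem[OF assms(1)[unfolded m]])
  moreover have "(a, b) \<noteq> (c, d)"
    using Gam_eq_iff[of p q] assms(4) p q by simp
  ultimately have "(a = c + 1 \<or> c = a + 1) \<and> (b = d + 1 \<or> d = b + 1) \<or> straight (a, b) (c, d)"
    unfolding straight_def by (elim insertE emptyE; simp)
  moreover have "adjK (a, b) (c, d) \<longleftrightarrow> (a = c + 1 \<or> c = a + 1) \<and> (b = d + 1 \<or> d = b + 1)"
    using pure_Gam[of p] pure_Gam[of q] unfolding p q by (rule adjK_pure_coords)
  ultimately show ?thesis
    unfolding adj8_iff p q by blast
qed

section \<open>Points of \<open>Gam_star C\<close>\<close>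

lemma cl_eq: "cl p = {q. p \<in> min_nbhd q}"
  using openin_min_nbhd by (auto simp: cl_def in_closure_of K2.topspace_UNIV) blast+

lemma Gam_star_pure: "pure u \<Longrightarrow> u \<in> Gam_star C \<longleftrightarrow> u \<in> Gam ` C"
  by (auto simp: Gam_star_def)

lemma Gam_in_Gam_star: "Gam p \<in> Gam_star C \<longleftrightarrow> p \<in> C"
  using Gam_star_pure[OF pure_Gam] inj_image_mem_iff[OF inj_Gam] by blast

text \<open>Smallest neighbourhood and closure of \<open>m\<close> are the row and the column
  through \<open>m\<close>, in an order depending on parity. Comparing them as an unordered pair
  removes this dependence, and each inclusion says that two opposite neighbours of \<open>m\<close>
  lie in the image.\<close>

lemma Gam_star_mixed:
  assumes "mixed m"
  shows "m \<in> Gam_star C \<longleftrightarrow> (\<exists>u. adjK m u \<and> u \<in> Gam ` C \<and> opp m u \<in> Gam ` C)"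
proof -
  obtain c d where m: "m = (c, d)"
    by fastforce
  let ?row = "{(c - 1, d), (c, d), (c + 1, d)}" and ?col = "{(c, d - 1), (c, d), (c, d + 1)}"
  have "{min_nbhd m, cl m} = {?row, ?col}"
  proof (cases "even c")
    case True
    then have "odd d"
      using assms by (auto simp: m pure_def)
    with True have "min_nbhd m = ?row" "cl m = ?col"
      by (auto simp: m min_nbhd_eq cl_eq nbhd_iff)
    then show ?thesis
      by simp
  next
    case False
    then have "even d"
      using assms by (auto simp: m pure_def)
    with False have "min_nbhd m = ?col" "cl m = ?row"
      by (auto simp: m min_nbhd_eq cl_eq nbhd_iff)
    then show ?thesis
      by (simp add: insert_commute)
  qed
  then have "min_nbhd m \<subseteq> Gam ` C \<union> {m} \<or> cl m \<subseteq> Gam ` C \<union> {m} \<longleftrightarrow>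
      ?row \<subseteq> Gam ` C \<union> {m} \<or> ?col \<subseteq> Gam ` C \<union> {m}"
    by (metis doubleton_eq_iff)
  also have "\<dots> \<longleftrightarrow> (c - 1, d) \<in> Gam ` C \<and> (c + 1, d) \<in> Gam ` C \<or>
      (c, d - 1) \<in> Gam ` C \<and> (c, d + 1) \<in> Gam ` C"
    by (simp add: m)
  also have "\<dots> \<longleftrightarrow> (\<exists>u. adjK m u \<and> u \<in> Gam ` C \<and> opp m u \<in> Gam ` C)"
  proof -
    have "adjK m (a, b) \<longleftrightarrow> (a, b) \<in> {(c + 1, d), (c - 1, d), (c, d + 1), (c, d - 1)}" for a b
      unfolding m adjK_mixed_mem[OF assms[unfolded m], symmetric] using K.sym by blast
    then have "{u. adjK m u} = {(c + 1, d), (c - 1, d), (c, d + 1), (c, d - 1)}"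
      by (intro set_eqI) (simp only: mem_Collect_eq split_paired_all)
    then have "(\<exists>u. adjK m u \<and> u \<in> Gam ` C \<and> opp m u \<in> Gam ` C) \<longleftrightarrow>
        (\<exists>u\<in>{(c + 1, d), (c - 1, d), (c, d + 1), (c, d - 1)}. u \<in> Gam ` C \<and> opp m u \<in> Gam ` C)"
      by blast
    then show ?thesis
      by (simp add: m opp_def) blast
  qed
  finally have "min_nbhd m \<subseteq> Gam ` C \<union> {m} \<or> cl m \<subseteq> Gam ` C \<union> {m} \<longleftrightarrow>
      (\<exists>u. adjK m u \<and> u \<in> Gam ` C \<and> opp m u \<in> Gam ` C)" .
  moreover have "m \<notin> Gam ` C"
    using assms pure_Gam by blast
  ultimately show ?thesis
    using assms by (simp add: Gam_star_def)
qed

lemma Gam_star_mixedE: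
  assumes "m \<in> Gam_star C" "mixed m"
  obtains p q where "p \<in> C" "q \<in> C" "p \<noteq> q" "adjK m (Gam p)" "adjK m (Gam q)" "adj8 p q"
    "Gam q = opp m (Gam p)"
proof -
  obtain p q where "p \<in> C" "q \<in> C" "adjK m (Gam p)" "Gam q = opp m (Gam p)"
    using assms Gam_star_mixed by fastforce
  then show thesis
    using that[of p q] adjK_mixed[OF assms(2), of "Gam p"] by (metis adj8_iff)
qed

lemma Gam_star_midpoint:
  assumes "p \<in> C" "q \<in> C" "adj8 p q" "\<not> adjK (Gam p) (Gam q)"
  obtains m where "m \<in> Gam_star C" "mixed m" "adjK m (Gam p)" "adjK m (Gam q)" "Gam q = opp m (Gam p)"
proof -
  have "straight (Gam p) (Gam q)"
    using assms(3,4) adj8_iff by blast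
  then obtain m where m: "mixed m" "adjK m (Gam p)" "Gam q = opp m (Gam p)"
    using straight_midpoint pure_Gam by metis
  then have "m \<in> Gam_star C"
    using Gam_star_mixed[OF m(1)] assms(1,2) by (metis imageI)
  then show thesis
    using that m adjK_mixed(2)[OF m(1,2)] by simp
qed

text \<open>Every added point is adjacent to some \<open>Gam p\<close> with
  \<open>p \<in> C\<close>, and a point has only finitely many neighbours.\<close>

lemma finite_Gam_star_iff: "finite (Gam_star C) \<longleftrightarrow> finite C"
proof
  assume "finite C"
  have "m \<in> {fst u - 1..fst u + 1} \<times> {snd u - 1..snd u + 1}" if "adjK m u" for u m
    using that by (cases u; cases m) (auto simp: adjK_coords nbhd_iff)
  then have "{m. adjK m u} \<subseteq> {fst u - 1..fst u + 1} \<times> {snd u - 1..snd u + 1}" for u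
    by blast
  then have fin: "finite {m. adjK m u}" for u
    by (rule finite_subset) simp
  have "Gam_star C \<subseteq> Gam ` C \<union> (\<Union>p\<in>C. {m. adjK m (Gam p)})"
  proof
    fix m assume m: "m \<in> Gam_star C"
    show "m \<in> Gam ` C \<union> (\<Union>p\<in>C. {m. adjK m (Gam p)})"
    proof (cases "pure m")
      case False
      then show ?thesis
        using m Gam_star_mixed by blast
    qed (use m Gam_star_pure in blast)
  qed
  then show "finite (Gam_star C)"
    using \<open>finite C\<close> fin by (meson finite_UN_I finite_UnI finite_imageI finite_subset)
next
  assume "finite (Gam_star C)"
  then have "finite (Gam ` C)"
    by (rule rev_finite_subset) (auto simp: Gam_star_def)
  then show "finite C"
    by (rule finite_imageD) (rule inj_on_subset[OF inj_Gam subset_UNIV])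
qed

lemma card_le_card_Gam_star:
  assumes "finite C"
  shows "card C \<le> card (Gam_star C)"
proof -
  have "card C = card (Gam ` C)"
    by (rule card_image[symmetric]) (rule inj_on_subset[OF inj_Gam subset_UNIV])
  also have "\<dots> \<le> card (Gam_star C)"
  proof (rule card_mono)
    show "finite (Gam_star C)"
      using assms by (simp add: finite_Gam_star_iff)
  qed (simp add: Gam_star_def)
  finally show ?thesis .
qed

section \<open>The subdivided graph\<close>

text \<open>As a graph, \<open>\<Gamma>\<^sup>*(C)\<close> is then \<open>C\<close> with every horizontal or vertical edge subdivided by its midpoint.\<close>

definition subdivides :: "(int \<times> int) set \<Rightarrow> bool" where
  "subdivides C \<longleftrightarrow> (\<forall>m\<in>Gam_star C. mixed m \<longrightarrow> card (K.nb (Gam_star C) m) = 2)"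

lemma two_le_card_nb_mixed:
  assumes "finite C" "m \<in> Gam_star C" "mixed m"
  shows "2 \<le> card (K.nb (Gam_star C) m)"
proof -
  obtain p q where pq: "p \<in> C" "q \<in> C" "p \<noteq> q" "adjK m (Gam p)" "adjK m (Gam q)"
    using Gam_star_mixedE[OF assms(2,3)] by metis
  then have "{Gam p, Gam q} \<subseteq> K.nb (Gam_star C) m" "Gam p \<noteq> Gam q"
    by (auto simp: K.nb_iff Gam_in_Gam_star)
  then show ?thesis
    using card_mono[of "K.nb (Gam_star C) m" "{Gam p, Gam q}"] assms(1)
    by (simp add: K.finite_nb finite_Gam_star_iff)
qed

text \<open>The opposite pair that put \<open>m\<close> into \<open>Gam_star C\<close> already
  exhausts its two neighbours, and reflection in \<open>m\<close> swaps this pair.\<close>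

lemma subdivides_nb:
  assumes "subdivides C" "m \<in> Gam_star C" "mixed m" "u \<in> K.nb (Gam_star C) m"
  shows "K.nb (Gam_star C) m = {u, opp m u}"
proof -
  obtain p q where pq: "p \<in> C" "q \<in> C" "p \<noteq> q" "adjK m (Gam p)" "adjK m (Gam q)"
    "Gam q = opp m (Gam p)"
    using Gam_star_mixedE[OF assms(2,3)] by metis
  have two: "card (K.nb (Gam_star C) m) = 2"
    using assms unfolding subdivides_def by blast
  have "Gam p \<in> K.nb (Gam_star C) m" "Gam q \<in> K.nb (Gam_star C) m"
    using pq(1,2,4,5) by (simp_all only: K.nb_iff Gam_in_Gam_star simp_thms)
  then have "{Gam p, Gam q} \<subseteq> K.nb (Gam_star C) m" "Gam p \<noteq> Gam q"
    using pq(3) by simp_all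
  \<comment> \<open>\<open>C\<close> may be infinite here; finiteness of the neighbour set comes
    from its cardinality being 2.\<close>
  then have nb: "{Gam p, Gam q} = K.nb (Gam_star C) m"
    using two card_ge_0_finite[of "K.nb (Gam_star C) m"] by (intro card_subset_eq) simp_all
  then consider "u = Gam p" | "u = opp m (Gam p)"
    using assms(4) unfolding pq(6) by blast
  then show ?thesis
    unfolding nb[symmetric] pq(6) by cases (simp_all add: insert_commute)
qed

text \<open>A neighbour of \<open>m\<close> other than the opposite pair would be pure, hence some
  \<open>Gam r\<close>, and \<open>mixed_nbs_adj8\<close> would make \<open>p\<close>,
  \<open>q\<close>, \<open>r\<close> a triangle.\<close>

lemma subdivides_if_no_triangle:
  assumes "\<And>p q r. \<lbrakk>p \<in> C; q \<in> C; r \<in> C; adj8 p q; adj8 q r\<rbrakk> \<Longrightarrow> \<not> adj8 p r"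
  shows "subdivides C"
  unfolding subdivides_def
proof (intro ballI impI)
  fix m assume m: "m \<in> Gam_star C" "mixed m"
  obtain p q where pq: "p \<in> C" "q \<in> C" "p \<noteq> q" "adjK m (Gam p)" "adjK m (Gam q)"
    "adj8 p q" "Gam q = opp m (Gam p)"
    using Gam_star_mixedE[OF m] by metis
  have "K.nb (Gam_star C) m = {Gam p, Gam q}"
  proof (intro equalityI subsetI)
    fix w assume w: "w \<in> K.nb (Gam_star C) m"
    then have "pure w"
      using adjK_mixed(1)[OF m(2)] by (simp add: K.nb_def)
    then obtain r where r: "w = Gam r" "r \<in> C"
      using w Gam_star_pure by (auto simp: K.nb_def)
    have mr: "adjK m (Gam r)"
      using w r by (simp add: K.nb_def)
    show "w \<in> {Gam p, Gam q}"
    proof (rule ccontr)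
      assume ne: "w \<notin> {Gam p, Gam q}"
      have "adj8 s r" if "adjK m (Gam s)" "Gam r \<noteq> Gam s" for s
        using mixed_nbs_adj8[OF m(2) that(1) mr] that(2) by blast
      then have "adj8 p r" "adj8 q r"
        using ne pq(4,5) r(1) by auto
      then show False
        using assms pq r(2) by blast
    qed
  next
    have "Gam p \<in> K.nb (Gam_star C) m" "Gam q \<in> K.nb (Gam_star C) m"
      using pq(1,2,4,5) by (simp_all only: K.nb_iff Gam_in_Gam_star simp_thms)
    then show "w \<in> K.nb (Gam_star C) m" if "w \<in> {Gam p, Gam q}" for w
      using that by blast
  qed
  then show "card (K.nb (Gam_star C) m) = 2"
    using pq(3) by simp
qed

text \<open>By \<open>straight_triangle\<close> the midpoint of a straight side would have the third
  vertex as an additional neighbour. So all sides are diagonal, which parity forbids.\<close>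

lemma subdivides_no_triangle:
  assumes "subdivides C" "p \<in> C" "q \<in> C" "r \<in> C" "adj8 p q" "adj8 q r"
  shows "\<not> adj8 p r"
proof
  assume pr: "adj8 p r"
  have aux: "adjK (Gam p) (Gam q)"
    if pqr: "p \<in> C" "q \<in> C" "r \<in> C" "adj8 p q" "adj8 q r" "adj8 p r" for p q r
  proof (rule ccontr)
    assume "\<not> ?thesis"
    then obtain m where m: "m \<in> Gam_star C" "mixed m" "adjK m (Gam p)" "adjK m (Gam q)"
      "Gam q = opp m (Gam p)"
      by (rule Gam_star_midpoint[OF pqr(1,2,4)])
    have "straight (Gam p) (Gam q)"
      using adjK_mixed(3)[OF m(2,3)] m(5) by simp
    then have "adjK m (Gam r)"
      using straight_triangle[OF pure_Gam pure_Gam pure_Gam _ _ _ m(2,3,5)] pqr(5,6) adj8_iff by blast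
    then have "Gam r \<in> K.nb (Gam_star C) m" "Gam p \<in> K.nb (Gam_star C) m"
      using m(3) pqr(1,3) by (simp_all add: K.nb_iff Gam_in_Gam_star)
    then have "Gam r \<in> {Gam p, Gam q}"
      using subdivides_nb[OF assms(1) m(1,2)] m(5) by metis
    then have "r = p \<or> r = q"
      by simp
    then show False
      using pqr(5,6) Z.irrefl by blast
  qed
  \<comment> \<open>The first coordinates under \<open>\<Gamma>\<close> would differ pairwise by an odd number.\<close>
  have "adjK (Gam p) (Gam q)" "adjK (Gam q) (Gam r)" "adjK (Gam p) (Gam r)"
    using aux[of p q r] aux[of q r p] aux[of p r q] assms pr Z.sym by blast+
  then have "odd (fst (Gam p) - fst (Gam q))" "odd (fst (Gam q) - fst (Gam r))"
    "odd (fst (Gam p) - fst (Gam r))"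
    using pure_adjK_odd pure_Gam by blast+
  then show False
    by presburger
qed

text \<open>The bijection \<open>h\<close> keeps diagonal neighbours of \<open>Gam p\<close> and
  sends the midpoint of a subdivided edge to its far end.\<close>

lemma subdivides_card_nb:
  assumes "subdivides C" "p \<in> C"
  shows "card (Z.nb C p) = card (K.nb (Gam_star C) (Gam p))"
proof -
  let ?J = "Gam_star C" and ?u = "Gam p"
  define h where "h w = (if pure w then w else opp w ?u)" for w
  have mixed_nb: "opp w ?u \<in> ?J" "adjK w ?u" if "w \<in> K.nb ?J ?u" "mixed w" for w
  proof -
    have w: "w \<in> ?J" "?u \<in> K.nb ?J w"
      using that(1) assms(2) K.sym by (auto simp: K.nb_iff Gam_in_Gam_star)
    then show "opp w ?u \<in> ?J" "adjK w ?u"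
      using subdivides_nb[OF assms(1) w(1) that(2) w(2)] K.nb_iff by blast+
  qed
  have h_straight: "straight ?u (h w)" if "w \<in> K.nb ?J ?u" "mixed w" for w
    using adjK_mixed(3)[OF that(2) mixed_nb(2)[OF that]] that(2) by (simp add: h_def)
  have h_diagonal: "h w = w" "adjK ?u w" "\<not> straight ?u w" if "w \<in> K.nb ?J ?u" "pure w" for w
    using that pure_adjK_not_straight[OF pure_Gam] by (auto simp: h_def K.nb_iff)
  \<comment> \<open>Values at pure and at mixed points differ because a diagonal neighbour is never
    straight; reflections of \<open>Gam p\<close> in distinct midpoints are distinct.\<close>
  have "inj_on h (K.nb ?J ?u)"
  proof (rule inj_onI)
    fix v w assume vw: "v \<in> K.nb ?J ?u" "w \<in> K.nb ?J ?u" "h v = h w"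
    show "v = w"
    proof (cases "pure v"; cases "pure w")
      assume "mixed v" "mixed w"
      then show ?thesis
        using vw(3) opp_inj_left by (simp add: h_def)
    qed (use vw h_straight h_diagonal in metis)+
  qed
  moreover have "h ` K.nb ?J ?u = Gam ` Z.nb C p"
  proof (intro equalityI subsetI)
    fix v assume "v \<in> h ` K.nb ?J ?u"
    then obtain w where w: "w \<in> K.nb ?J ?u" "v = h w"
      by blast
    have "v \<in> ?J" "pure v"
      using w mixed_nb pure_Gam by (auto simp: h_def K.nb_iff)
    then obtain q where q: "q \<in> C" "v = Gam q"
      using Gam_star_pure by blast
    have "adjK ?u v \<or> straight ?u v"
      using w h_straight h_diagonal by metis
    then show "v \<in> Gam ` Z.nb C p"
      using q adj8_iff by (auto simp: Z.nb_iff)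
  next
    fix v assume "v \<in> Gam ` Z.nb C p"
    then obtain q where q: "q \<in> C" "adj8 p q" "v = Gam q"
      by (auto simp: Z.nb_iff)
    show "v \<in> h ` K.nb ?J ?u"
    proof (cases "adjK ?u v")
      case True
      then have "v \<in> K.nb ?J ?u" "h v = v"
        using q pure_Gam by (auto simp: K.nb_iff h_def Gam_in_Gam_star)
      then show ?thesis
        by (metis imageI)
    next
      case False
      then obtain m where "m \<in> ?J" "mixed m" "adjK m ?u" "v = opp m ?u"
        using Gam_star_midpoint[OF assms(2) q(1,2)] q(3) by metis
      then have "m \<in> K.nb ?J ?u" "h m = v"
        using K.sym by (auto simp: K.nb_iff h_def)
      then show ?thesis
        by blast
    qed
  qed
  ultimately have "card (K.nb ?J ?u) = card (Gam ` Z.nb C p)"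
    by (metis card_image)
  then show ?thesis
    by (simp add: card_image inj_on_subset[OF inj_Gam])
qed

lemma gconn_Gam_star:
  assumes "Z.gconn C"
  shows "K.gconn (Gam_star C)"
  unfolding K.gconn_def
proof (intro allI impI, elim conjE)
  fix S assume S: "S \<subseteq> Gam_star C" "S \<noteq> {}" "\<forall>u\<in>S. \<forall>v\<in>Gam_star C. adjK u v \<longrightarrow> v \<in> S"
  have "{c \<in> C. Gam c \<in> S} = C"
  proof (rule Z.gconnD[OF assms])
    obtain s where s: "s \<in> S"
      using S(2) by blast
    have "\<exists>c\<in>C. Gam c \<in> S"
    proof (cases "pure s")
      case True
      then show ?thesis
        using s S(1) Gam_star_pure by blast
    next
      case False
      then obtain p where "p \<in> C" "adjK s (Gam p)"
        using Gam_star_mixedE s S(1) by (metis subsetD)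
      then show ?thesis
        using S(3) s Gam_in_Gam_star by blast
    qed
    then show "{c \<in> C. Gam c \<in> S} \<noteq> {}"
      by blast
  next
    fix p q assume "p \<in> {c \<in> C. Gam c \<in> S}" and q: "q \<in> C" "adj8 p q"
    then have p: "p \<in> C" "Gam p \<in> S"
      by auto
    have "Gam q \<in> S"
    proof (cases "adjK (Gam p) (Gam q)")
      case True
      then show ?thesis
        using S(3) p(2) q(1) Gam_in_Gam_star by blast
    next
      case False
      then obtain m where m: "m \<in> Gam_star C" "adjK m (Gam p)" "adjK m (Gam q)"
        using Gam_star_midpoint[OF p(1) q] by metis
      then have "m \<in> S"
        using S(3) p(2) K.sym by blast
      then show ?thesis
        using S(3) m(3) q(1) Gam_in_Gam_star by blast
    qed
    then show "q \<in> {c \<in> C. Gam c \<in> S}"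
      using q(1) by blast
  qed blast
  then have C: "Gam c \<in> S" if "c \<in> C" for c
    using that by blast
  have "m \<in> S" if m: "m \<in> Gam_star C" for m
  proof (cases "pure m")
    case True
    then show ?thesis
      using m C Gam_star_pure by blast
  next
    case False
    then obtain p where "p \<in> C" "adjK m (Gam p)"
      using Gam_star_mixedE m by metis
    then show ?thesis
      using C S(3) m K.sym by blast
  qed
  then show "S = Gam_star C"
    using S(1) by blast
qed

lemma gconn_if_gconn_Gam_star:
  assumes "subdivides C" "K.gconn (Gam_star C)"
  shows "Z.gconn C"
  unfolding Z.gconn_def
proof (intro allI impI, elim conjE)
  fix S assume S: "S \<subseteq> C" "S \<noteq> {}" "\<forall>p\<in>S. \<forall>q\<in>C. adj8 p q \<longrightarrow> q \<in> S"
  \<comment> \<open>\<open>S\<close> together with the midpoints touching it. It is closed because a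
    midpoint leads only to the two ends of its edge, which are 8-adjacent.\<close>
  define T where "T = Gam ` S \<union> {m \<in> Gam_star C. mixed m \<and> (\<exists>p\<in>S. adjK m (Gam p))}"
  have pure_T: "Gam p \<in> T \<longleftrightarrow> p \<in> S" for p
    using pure_Gam by (auto simp: T_def simp del: split_paired_All split_paired_Ex)
  have "T = Gam_star C"
  proof (rule K.gconnD[OF assms(2)])
    show "T \<subseteq> Gam_star C"
      using S(1) Gam_in_Gam_star by (auto simp: T_def)
    show "T \<noteq> {}"
      using S(2) by (auto simp: T_def)
    fix u v assume u: "u \<in> T" and v: "v \<in> Gam_star C" "adjK u v"
    show "v \<in> T"
    proof (cases "pure u")
      case True
      then obtain p where p: "u = Gam p" "p \<in> S"
        using u by (auto simp: T_def)
      show ?thesis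
      proof (cases "pure v")
        case True
        then obtain q where q: "v = Gam q" "q \<in> C"
          using v(1) Gam_star_pure by blast
        then have "adj8 p q"
          using v(2) p(1) adj8_iff by blast
        then show ?thesis
          using S(3) p(2) q pure_T by blast
      next
        case False
        moreover have "adjK v (Gam p)"
          using v(2) p(1) K.sym by blast
        ultimately show ?thesis
          using v(1) p(2) unfolding T_def by blast
      qed
    next
      case False
      then obtain p where p: "p \<in> S" "adjK u (Gam p)" and uJ: "u \<in> Gam_star C"
        using u pure_Gam by (auto simp: T_def)
      then have "Gam p \<in> K.nb (Gam_star C) u"
        using S(1) by (auto simp: K.nb_iff Gam_in_Gam_star)
      then have "v = Gam p \<or> v = opp u (Gam p)"
        using subdivides_nb[OF assms(1) uJ False] v by (metis K.nb_iff insertE singletonD)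
      then show ?thesis
      proof
        assume v': "v = opp u (Gam p)"
        then obtain q where q: "v = Gam q" "q \<in> C"
          using v(1) Gam_star_pure pure_opp pure_Gam by blast
        then have "adj8 p q"
          using adjK_mixed(3)[OF False p(2)] v' adj8_iff by metis
        then show ?thesis
          using S(3) p(1) q pure_T by blast
      qed (use p pure_T in blast)
    qed
  qed
  then have "c \<in> S" if "c \<in> C" for c
    using that pure_T Gam_in_Gam_star by blast
  then show "S = C"
    using S(1) by blast
qed

section \<open>Transfer of induced paths and cycles\<close>

lemma induced_path_Gam_star:
  assumes "Z.induced_path C"
  shows "K.induced_path (Gam_star C)" "subdivides C"
proof -
  show sub: "subdivides C"
    using Z.induced_path_no_triangle[OF assms] by (rule subdivides_if_no_triangle)
  have C: "card C \<ge> 2" "Z.gconn C" "\<And>p. p \<in> C \<Longrightarrow> card (Z.nb C p) \<le> 2"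
    "\<exists>p\<in>C. card (Z.nb C p) \<le> 1"
    using assms[unfolded Z.induced_path_iff] by simp_all
  have "finite C"
    using C(1) by (intro card_ge_0_finite) simp
  have "card (K.nb (Gam_star C) u) \<le> 2" if u: "u \<in> Gam_star C" for u
  proof (cases "pure u")
    case True
    then obtain p where "p \<in> C" "u = Gam p"
      using u Gam_star_pure by blast
    then show ?thesis
      using C(3) subdivides_card_nb[OF sub] by simp
  next
    case False
    then show ?thesis
      using sub u by (simp add: subdivides_def)
  qed
  moreover have "\<exists>u\<in>Gam_star C. card (K.nb (Gam_star C) u) \<le> 1"
    using C(4) subdivides_card_nb[OF sub] Gam_in_Gam_star by metis
  ultimately show "K.induced_path (Gam_star C)"
    unfolding K.induced_path_iff
    using C(1) card_le_card_Gam_star[OF \<open>finite C\<close>] gconn_Gam_star[OF C(2)] by simp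
qed

text \<open>Mixed points always have at least two neighbours. So the degree bound yields
  \<open>subdivides\<close>, and a point of degree at most 1 is pure and comes from a point of
  \<open>C\<close> of the same degree.\<close>

lemma induced_path_if_Gam_star:
  assumes "K.induced_path (Gam_star C)"
  shows "Z.induced_path C"
proof -
  have J: "card (Gam_star C) \<ge> 2" "K.gconn (Gam_star C)"
    "\<And>u. u \<in> Gam_star C \<Longrightarrow> card (K.nb (Gam_star C) u) \<le> 2"
    "\<exists>u\<in>Gam_star C. card (K.nb (Gam_star C) u) \<le> 1"
    using assms[unfolded K.induced_path_iff] by simp_all
  have "finite (Gam_star C)"
    using J(1) by (intro card_ge_0_finite) simp
  then have fin: "finite C"
    by (simp add: finite_Gam_star_iff)
  have sub: "subdivides C"
    unfolding subdivides_def using J(3) two_le_card_nb_mixed[OF fin] le_antisym by blast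
  obtain u where u: "u \<in> Gam_star C" "card (K.nb (Gam_star C) u) \<le> 1"
    using J(4) by blast
  have "pure u"
    using two_le_card_nb_mixed[OF fin u(1)] u(2) by linarith
  then obtain p where p: "p \<in> C" "u = Gam p"
    using u(1) Gam_star_pure by blast
  \<comment> \<open>A single point creates no midpoints, so \<open>Gam_star C\<close> would have
    only one point.\<close>
  have "C \<noteq> {p}"
  proof
    assume C: "C = {p}"
    have "Gam_star C \<subseteq> Gam ` C"
    proof
      fix m assume m: "m \<in> Gam_star C"
      have "pure m"
        using Gam_star_mixedE[OF m] unfolding C by blast
      then show "m \<in> Gam ` C"
        using m Gam_star_pure by blast
    qed
    then have "Gam_star C \<subseteq> {Gam p}"
      by (simp add: C)
    then show False
      using J(1) card_mono[of "{Gam p}" "Gam_star C"] by simp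
  qed
  then obtain q where "q \<in> C" "q \<noteq> p"
    using p(1) by blast
  then have "card C \<ge> 2"
    using p(1) card_mono[OF fin, of "{p, q}"] by simp
  moreover have "card (Z.nb C q) \<le> 2" if "q \<in> C" for q
    using that J(3) subdivides_card_nb[OF sub] Gam_in_Gam_star by simp
  moreover have "card (Z.nb C p) \<le> 1"
    using p u(2) subdivides_card_nb[OF sub] by simp
  ultimately show ?thesis
    unfolding Z.induced_path_iff using gconn_if_gconn_Gam_star[OF sub J(2)] p(1) by blast
qed

lemma induced_cycle_Gam_star:
  assumes "Z.induced_cycle C"
  shows "K.induced_cycle (Gam_star C)"
proof -
  have sub: "subdivides C"
    using Z.induced_cycle_no_triangle[OF assms] by (rule subdivides_if_no_triangle)
  have C: "finite C" "card C \<ge> 4" "Z.gconn C" "\<And>p. p \<in> C \<Longrightarrow> card (Z.nb C p) = 2"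
    using assms[unfolded Z.induced_cycle_def] by simp_all
  have "card (K.nb (Gam_star C) u) = 2" if u: "u \<in> Gam_star C" for u
  proof (cases "pure u")
    case True
    then obtain p where "p \<in> C" "u = Gam p"
      using u Gam_star_pure by blast
    then show ?thesis
      using C(4) subdivides_card_nb[OF sub] by simp
  next
    case False
    then show ?thesis
      using sub u by (simp add: subdivides_def)
  qed
  then show ?thesis
    unfolding K.induced_cycle_def
    using C(2) card_le_card_Gam_star[OF C(1)] gconn_Gam_star[OF C(3)]
    by (simp add: finite_Gam_star_iff C(1))
qed

text \<open>Midpoints count towards \<open>card (Gam_star C)\<close>, so four points of
  \<open>C\<close> are found directly: \<open>p\<close>, its neighbours \<open>q\<close> and
  \<open>r\<close>, and the other neighbour \<open>s\<close> of \<open>q\<close>, which differs from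
  \<open>r\<close> because there is no triangle.\<close>

lemma induced_cycle_if_Gam_star:
  assumes "K.induced_cycle (Gam_star C)"
  shows "Z.induced_cycle C"
proof -
  have J: "finite (Gam_star C)" "card (Gam_star C) \<ge> 4" "K.gconn (Gam_star C)"
    "\<And>u. u \<in> Gam_star C \<Longrightarrow> card (K.nb (Gam_star C) u) = 2"
    using assms[unfolded K.induced_cycle_def] by simp_all
  have fin: "finite C"
    using J(1) by (simp add: finite_Gam_star_iff)
  have sub: "subdivides C"
    using J(4) by (simp add: subdivides_def)
  have two: "card (Z.nb C p) = 2" if "p \<in> C" for p
    using that J(4) subdivides_card_nb[OF sub] Gam_in_Gam_star by simp
  have "Gam_star C \<noteq> {}"
    using J(2) by auto
  then obtain u where u: "u \<in> Gam_star C"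
    by blast
  obtain p where p: "p \<in> C"
  proof (cases "pure u")
    case True
    then show thesis
      using u Gam_star_pure that by blast
  next
    case False
    then show thesis
      using Gam_star_mixedE[OF u] that by blast
  qed
  obtain q r where qr: "Z.nb C p = {q, r}" "q \<noteq> r"
    using two[OF p] by (auto simp: card_2_iff)
  then have q: "q \<in> C" "adj8 p q" and r: "r \<in> C" "adj8 p r"
    using Z.nb_iff[of q C p] Z.nb_iff[of r C p] by simp_all
  have "\<not> Z.nb C q \<subseteq> {p}"
    using two[OF q(1)] card_mono[of "{p}" "Z.nb C q"] by auto
  then obtain s where s: "s \<in> C" "adj8 q s" "s \<noteq> p"
    using Z.nb_iff by blast
  have "s \<noteq> r"
    using subdivides_no_triangle[OF sub p q(1) r(1) q(2)] s(2) r(2) by blast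
  moreover have "p \<noteq> q" "p \<noteq> r" "q \<noteq> s"
    using q(2) r(2) s(2) Z.irrefl by blast+
  ultimately have "card {p, q, r, s} = 4"
    using qr(2) s(3) by simp
  then have "card C \<ge> 4"
    using card_mono[OF fin, of "{p, q, r, s}"] p q(1) r(1) s(1) by simp
  then show ?thesis
    unfolding Z.induced_cycle_def using fin two gconn_if_gconn_Gam_star[OF sub J(3)] by blast
qed

theorem theorem4p7:
  fixes C :: "(int \<times> int) set"
  shows "(path8 C \<longleftrightarrow>
            arc_K2 (Gam_star C) \<and> (\<forall>x \<in> arc_endpoints (Gam_star C). pure x)) \<and>
         (closed_curve8 C \<longleftrightarrow> Jordan_curve_K2 (Gam_star C))"
proof -
  have "pure x" if "Z.induced_path C" "x \<in> arc_endpoints (Gam_star C)" for x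
  proof (rule ccontr)
    assume "mixed x"
    moreover have "x \<in> Gam_star C" "card (K.nb (Gam_star C) x) = 1"
      using that(2) by (auto simp: arc_endpoints_def adj_set_eq K.nb_def Int_def conj_commute)
    \<comment> \<open>An endpoint has degree 1, whereas \<open>subdivides\<close> gives mixed points
      degree 2.\<close>
    ultimately show False
      using induced_path_Gam_star(2)[OF that(1)] by (auto simp: subdivides_def)
  qed
  moreover have "Z.induced_path C \<longleftrightarrow> K.induced_path (Gam_star C)"
    using induced_path_Gam_star(1) induced_path_if_Gam_star by (rule iffI)
  moreover have "Z.induced_cycle C \<longleftrightarrow> K.induced_cycle (Gam_star C)"
    using induced_cycle_Gam_star induced_cycle_if_Gam_star by (rule iffI)
  ultimately show ?thesis
    unfolding path8_iff arc_K2_iff closed_curve8_iff Jordan_curve_K2_iff by metis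
qed

end
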